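(* Let $n \geq 1$ be an integer and let $\epsilon > 0$. Then there is a constant $C = C(n,\epsilon) > 0$, depending only on $n$ and $\epsilon$, such that for all real numbers $X \geq 1$ and $N \geq 1$ and every function $c : \mathbb{Z}^n \to \mathbb{C}$, \[ \sum_{\substack{\beta \in \mathbb{R}^n/\mathbb{Z}^n \\ \mathrm{ord}(\beta) \leq X}} \left| \sum_{\substack{\alpha=(\alpha_1, \dots, \alpha_n)\in \mathbb{Z}^n \\ \max_{1\leq i \leq n}|\alpha_i|\leq N}} c(\alpha)\, e ( \alpha \cdot \beta) \right|^2 \leq C\, X^{\epsilon} \left( X^{n+1}+N^{n-1}X^2 + N^n \right) \sum_{\substack{\alpha=(\alpha_1, \dots, \alpha_n)\in \mathbb{Z}^n \\ \max_{1\leq i \leq n}|\alpha_i|\leq N}} |c(\alpha)|^2 . \]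
   Context: Here $e(z) = e^{2\pi i z}$ and $\alpha\cdot\beta$ is the usual dot product in $\mathbb{R}^n$; for $\alpha \in \mathbb{Z}^n$ the value $e(\alpha\cdot\beta)$ is well defined for $\beta \in \mathbb{R}^n/\mathbb{Z}^n$. For $\beta \in \mathbb{R}^n/\mathbb{Z}^n$, $\mathrm{ord}(\beta)$ denotes the additive order of $\beta$ in the group $\mathbb{R}^n/\mathbb{Z}^n$ (elements of infinite order do not satisfy $\mathrm{ord}(\beta)\le X$). Thus if $\beta = (a_1/q_1, \dots, a_n/q_n)$ with each fraction in lowest terms and $q_i \geq 1$, then $\mathrm{ord}(\beta) = \mathrm{lcm}(q_1,\dots,q_n)$. *)

theory Defs
  imports "HOL-Analysis.Analysis" "HOL-Algebra.Multiplicative_Group"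
begin

definition e :: "complex \<Rightarrow> complex"
  where "e z = exp (2 * of_real pi * \<i> * z)"

definition euclidean_group :: "(real ^ 'n) monoid"
  where "euclidean_group = \<lparr>carrier = UNIV, mult = (+), one = 0\<rparr>"

definition integer_lattice :: "(real ^ 'n) set"
  where "integer_lattice = {x. \<forall>i. x $ i \<in> \<int>}"

definition torus :: "(real ^ 'n) set monoid"
  where "torus = euclidean_group Mod integer_lattice"

definition of_int_vec :: "int ^ 'n \<Rightarrow> real ^ 'n"
  where "of_int_vec \<alpha> = (\<chi> i. real_of_int (\<alpha> $ i))"

text \<open>The value of \<^term>\<open>e (of_real (of_int_vec \<alpha> \<bullet> x))\<close>, which is the same for all
  representatives \<open>x\<close> of the coset \<open>\<beta>\<close> (see \<open>torus_char_coset\<close> below).\<close>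

definition torus_char :: "int ^ 'n \<Rightarrow> (real ^ 'n) set \<Rightarrow> complex"
  where "torus_char \<alpha> \<beta> = the_elem ((\<lambda>x. e (of_real (of_int_vec \<alpha> \<bullet> x))) ` \<beta>)"

text \<open>\<^const>\<open>group.ord\<close> is \<open>0\<close> on elements of infinite order, so these are excluded explicitly.\<close>

definition torus_points :: "real \<Rightarrow> (real ^ 'n) set set"
  where "torus_points X =
    {\<beta> \<in> carrier torus. group.ord torus \<beta> \<noteq> 0 \<and> real (group.ord torus \<beta>) \<le> X}"

definition integer_box :: "real \<Rightarrow> (int ^ 'n) set"
  where "integer_box N = {\<alpha>. real_of_int (MAX i\<in>UNIV. \<bar>\<alpha> $ i\<bar>) \<le> N}"


lemma euclidean_group_simps [simp]:
  "carrier euclidean_group = UNIV" "x \<otimes>\<^bsub>euclidean_group\<^esub> y = x + y"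
  "\<one>\<^bsub>euclidean_group\<^esub> = 0"
  by (simp_all add: euclidean_group_def)

lemma comm_group_euclidean_group: "comm_group (euclidean_group :: (real ^ 'n) monoid)"
proof (rule comm_groupI)
  fix x :: "real ^ 'n"
  show "\<exists>y\<in>carrier euclidean_group. y \<otimes>\<^bsub>euclidean_group\<^esub> x = \<one>\<^bsub>euclidean_group\<^esub>"
    by (auto intro: exI[of _ "- x"])
qed (auto simp: algebra_simps)

lemma inv_euclidean_group: "inv\<^bsub>euclidean_group\<^esub> x = - (x :: real ^ 'n)"
  using comm_group.axioms(2)[OF comm_group_euclidean_group]
  by (intro group.inv_equality) auto

lemma subgroup_integer_lattice:
  "subgroup integer_lattice (euclidean_group :: (real ^ 'n) monoid)"
  using comm_group.axioms(2)[OF comm_group_euclidean_group]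
  by unfold_locales (auto simp: integer_lattice_def inv_euclidean_group)

lemma normal_integer_lattice:
  "integer_lattice \<lhd> (euclidean_group :: (real ^ 'n) monoid)"
  using comm_group.normal_iff_subgroup[OF comm_group_euclidean_group] subgroup_integer_lattice
  by blast

lemma comm_group_torus: "comm_group (torus :: (real ^ 'n) set monoid)"
  unfolding torus_def
  by (rule comm_group.abelian_FactGroup[OF comm_group_euclidean_group subgroup_integer_lattice])

lemma mem_coset_iff:
  "y \<in> integer_lattice #>\<^bsub>euclidean_group\<^esub> x \<longleftrightarrow> y - (x :: real ^ 'n) \<in> integer_lattice"
proof
  assume "y - x \<in> integer_lattice"
  then show "y \<in> integer_lattice #>\<^bsub>euclidean_group\<^esub> x"
    unfolding r_coset_def by (auto intro!: bexI[of _ "y - x"])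
qed (auto simp: r_coset_def)

lemma carrier_torus:
  "carrier torus = range (\<lambda>x :: real ^ 'n. integer_lattice #>\<^bsub>euclidean_group\<^esub> x)"
  by (simp add: torus_def carrier_FactGroup)

lemma pow_euclidean_group: "x [^]\<^bsub>euclidean_group\<^esub> (k :: nat) = real k *\<^sub>R (x :: real ^ 'n)"
proof -
  interpret comm_group "euclidean_group :: (real ^ 'n) monoid"
    by (rule comm_group_euclidean_group)
  show ?thesis by (induction k) (auto simp: algebra_simps)
qed

lemma torus_pow_eq_one_iff:
  fixes x :: "real ^ 'n" and k :: nat
  shows "(integer_lattice #>\<^bsub>euclidean_group\<^esub> x) [^]\<^bsub>torus\<^esub> k = \<one>\<^bsub>torus\<^esub>
    \<longleftrightarrow> real k *\<^sub>R x \<in> integer_lattice"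
proof -
  note G = comm_group.axioms(2)[OF comm_group_euclidean_group]
  have "(integer_lattice #>\<^bsub>euclidean_group\<^esub> x) [^]\<^bsub>torus\<^esub> k
      = integer_lattice #>\<^bsub>euclidean_group\<^esub> (real k *\<^sub>R x)"
    unfolding torus_def
    by (subst normal.FactGroup_pow[OF normal_integer_lattice]) (auto simp: pow_euclidean_group)
  moreover have "integer_lattice #>\<^bsub>euclidean_group\<^esub> y = integer_lattice \<longleftrightarrow> y \<in> integer_lattice"
    for y :: "real ^ 'n"
    using group.coset_join1[OF G _ _ subgroup_integer_lattice, of y]
      group.coset_join2[OF G _ subgroup_integer_lattice, of y] by auto
  ultimately show ?thesis by (simp add: torus_def)
qed

lemma torus_char_coset:
  fixes x :: "real ^ 'n"
  shows "torus_char \<alpha> (integer_lattice #>\<^bsub>euclidean_group\<^esub> x) = e (of_real (of_int_vec \<alpha> \<bullet> x))"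
proof -
  have eq: "e (of_real (of_int_vec \<alpha> \<bullet> y)) = e (of_real (of_int_vec \<alpha> \<bullet> x))"
    if "y \<in> integer_lattice #>\<^bsub>euclidean_group\<^esub> x" for y
  proof -
    have "of_int_vec \<alpha> \<bullet> (y - x) \<in> \<int>"
      using that unfolding mem_coset_iff
      by (auto simp: inner_vec_def of_int_vec_def integer_lattice_def intro!: Ints_sum Ints_mult)
    then obtain m where "of_int_vec \<alpha> \<bullet> y - of_int_vec \<alpha> \<bullet> x = of_int m"
      by (auto simp: inner_diff_right elim: Ints_cases)
    then have "of_int_vec \<alpha> \<bullet> y = of_int_vec \<alpha> \<bullet> x + of_int m"
      by simp
    then show ?thesis
      unfolding e_def exp_eq by (intro exI[of _ m]) (simp add: algebra_simps)
  qed
  have "x \<in> integer_lattice #>\<^bsub>euclidean_group\<^esub> x"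
    unfolding mem_coset_iff by (simp add: integer_lattice_def)
  with eq have "(\<lambda>x. e (of_real (of_int_vec \<alpha> \<bullet> x))) ` (integer_lattice #>\<^bsub>euclidean_group\<^esub> x)
      = {e (of_real (of_int_vec \<alpha> \<bullet> x))}"
    by blast
  then show ?thesis by (simp add: torus_char_def)
qed

lemma finite_vec_components:
  assumes "finite S"
  shows "finite {y :: 'a ^ 'n. \<forall>i. y $ i \<in> S}"
proof -
  have "finite (vec_lambda ` (UNIV \<rightarrow>\<^sub>E S) :: ('a ^ 'n) set)"
    using assms by (intro finite_imageI finite_PiE) auto
  then show ?thesis
  proof (rule rev_finite_subset, intro subsetI)
    fix y :: "'a ^ 'n"
    assume "y \<in> {y. \<forall>i. y $ i \<in> S}"
    then have "vec_nth y \<in> UNIV \<rightarrow>\<^sub>E S" by auto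
    then show "y \<in> vec_lambda ` (UNIV \<rightarrow>\<^sub>E S)"
      by (metis imageI vec_nth_inverse)
  qed
qed

text \<open>Both index sets are finite, so the sums over them are genuine sums.\<close>

lemma finite_integer_box: "finite (integer_box N :: (int ^ 'n) set)"
proof (rule finite_subset)
  show "integer_box N \<subseteq> {\<alpha> :: int ^ 'n. \<forall>i. \<alpha> $ i \<in> {- \<lfloor>N\<rfloor>..\<lfloor>N\<rfloor>}}"
  proof (clarify)
    fix \<alpha> :: "int ^ 'n" and i
    assume "\<alpha> \<in> integer_box N"
    then have "(MAX i\<in>UNIV. \<bar>\<alpha> $ i\<bar>) \<le> \<lfloor>N\<rfloor>"
      by (simp add: integer_box_def le_floor_iff)
    moreover have "\<bar>\<alpha> $ i\<bar> \<le> (MAX i\<in>UNIV. \<bar>\<alpha> $ i\<bar>)"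
      by (rule Max_ge) auto
    ultimately have "\<bar>\<alpha> $ i\<bar> \<le> \<lfloor>N\<rfloor>" by (rule order_trans[rotated])
    then show "\<alpha> $ i \<in> {- \<lfloor>N\<rfloor>..\<lfloor>N\<rfloor>}" by (auto simp: abs_le_iff)
  qed
qed (rule finite_vec_components, simp)

lemma finite_torus_points: "finite (torus_points X :: (real ^ 'n) set set)"
proof -
  define S :: "real set" where
    "S = (\<lambda>(m, q). real_of_int m / real q) ` ({0..\<lfloor>X\<rfloor>} \<times> {0..nat \<lfloor>X\<rfloor>})"
  have S: "finite S" by (simp add: S_def)
  have "torus_points X \<subseteq> (\<lambda>y :: real ^ 'n. integer_lattice #>\<^bsub>euclidean_group\<^esub> y) ` {y. \<forall>i. y $ i \<in> S}"
  proof
    fix \<beta> :: "(real ^ 'n) set"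
    assume "\<beta> \<in> torus_points X"
    then obtain x q where \<beta>: "\<beta> = integer_lattice #>\<^bsub>euclidean_group\<^esub> x" and
      mem: "\<beta> \<in> carrier torus" and q: "q = group.ord torus \<beta>" "q \<noteq> 0" "real q \<le> X"
      by (auto simp: torus_points_def carrier_torus)
    have "\<beta> [^]\<^bsub>torus\<^esub> q = \<one>\<^bsub>torus\<^esub>"
      unfolding q(1) by (rule group.pow_ord_eq_1[OF comm_group.axioms(2)[OF comm_group_torus] mem])
    then have qx: "real q *\<^sub>R x \<in> integer_lattice"
      by (simp add: \<beta> torus_pow_eq_one_iff)
    define y where "y = (\<chi> i. frac (x $ i))"
    have "y \<in> integer_lattice #>\<^bsub>euclidean_group\<^esub> x"
      unfolding mem_coset_iff by (auto simp: integer_lattice_def y_def frac_def)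
    then have "\<beta> = integer_lattice #>\<^bsub>euclidean_group\<^esub> y"
      unfolding \<beta>
      by (intro group.repr_independence[OF comm_group.axioms(2)[OF comm_group_euclidean_group]]
          subgroup_integer_lattice) auto
    moreover have "y $ i \<in> S" for i
    proof -
      have "real q * x $ i \<in> \<int>" using qx by (auto simp: integer_lattice_def)
      then have "real q * (x $ i) - real q * of_int \<lfloor>x $ i\<rfloor> \<in> \<int>" by simp
      then obtain m where "real q * (x $ i) - real q * of_int \<lfloor>x $ i\<rfloor> = of_int m"
        by (rule Ints_cases)
      then have m: "real q * y $ i = of_int m"
        by (simp add: y_def frac_def algebra_simps)
      have "0 \<le> y $ i" "y $ i < 1" by (auto simp: y_def frac_lt_1)
      then have "0 \<le> real_of_int m" "real_of_int m \<le> real q"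
        unfolding m[symmetric] by (auto intro: mult_left_le)
      then have "m \<in> {0..\<lfloor>X\<rfloor>}" using q(3) by (auto simp: le_floor_iff)
      moreover have "q \<in> {0..nat \<lfloor>X\<rfloor>}" using q(3) by (auto simp: le_nat_floor)
      moreover have "y $ i = real_of_int m / real q" using m q(2) by (simp add: field_simps)
      ultimately show ?thesis unfolding S_def by (intro image_eqI[of _ _ "(m, q)"]) auto
    qed
    ultimately show "\<beta> \<in> (\<lambda>y. integer_lattice #>\<^bsub>euclidean_group\<^esub> y) ` {y. \<forall>i. y $ i \<in> S}"
      by blast
  qed
  then show ?thesis
    by (rule finite_subset) (rule finite_imageI[OF finite_vec_components[OF S]])
qed

end

theory Submission
  imports Defs
begin

text \<open>
  By duality and a summable majorant of the kernel, the large sieve constant is \<open>O(N\<^sup>n K)\<close>, where \<open>K\<close> is the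
  largest number of torsion points of order at most \<open>X\<close> in a box of side \<open>l = 1 / (3 N)\<close>. It remains to
  see that \<open>K = O(X\<^sup>\<epsilon> (X\<^sup>n\<^sup>+\<^sup>1 l\<^sup>n + X\<^sup>2 l + 1))\<close>.
  If \<open>X l \<ge> 1\<close>, count the points of each order \<open>q\<close> separately. If \<open>X l < 1\<close>, there are only boundedly
  many points of each order, so the orders have to be counted. For this, a point \<open>y\<close> of order \<open>q\<close> is
  projected to \<open>k \<bullet> y\<close> for some \<open>k\<close> with bounded nonnegative integer entries such that \<open>k \<bullet> y\<close> still
  has order at least \<open>q / O(X\<^sup>\<delta>)\<close>: then \<open>k \<bullet> y\<close> is a rational with denominator at most \<open>X\<close> in an
  interval of length \<open>O(l)\<close>, for which there are \<open>O(1 + X\<^sup>2 l)\<close> possibilities, and it determines the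
  order of \<open>y\<close> up to \<open>O(X\<^sup>\<delta>)\<close> choices.
\<close>

subsection \<open>Integer combinations of nearly full order\<close>

lemma gcd_mult_dvd: "gcd (a * b) c dvd gcd a c * gcd b (c::nat)"
proof -
  have "gcd a c * gcd b c = gcd (gcd a c * b) (gcd a c * c)"
    by (rule gcd_mult_distrib_nat)
  also have "gcd a c * b = gcd (a * b) (c * b)"
    using gcd_mult_distrib_nat[of b a c] by (simp add: mult.commute)
  finally show ?thesis
    by (auto intro: gcd_greatest dvd_mult dvd_mult2)
qed

text \<open>Pairwise coprime divisors of \<open>q\<close> would have a product dividing
  \<open>q\<close>. In general the product is lcm times gcd: adding the factor \<open>m T\<close>
  keeps the lcm a divisor, and its gcd with the earlier product divides the product of the pairwise
  gcds, hence the product of all \<open>T - t\<close>, which is \<open>fact T\<close>.\<close>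

lemma prod_dvd_of_gcd_dvd_diff:
  fixes m :: "nat \<Rightarrow> nat"
  assumes dvd: "\<And>t. t < T \<Longrightarrow> m t dvd q"
    and gcd: "\<And>s t. s < t \<Longrightarrow> t < T \<Longrightarrow> gcd (m s) (m t) dvd t - s"
  shows "(\<Prod>t<T. m t) dvd q * (\<Prod>t<T. fact t)"
  using assms
proof (induction T)
  case (Suc T)
  define P A where "P = (\<Prod>t<T. m t)" and "A = q * (\<Prod>t<T. fact t)"
  have "P dvd A" unfolding P_def A_def using Suc by (intro Suc.IH) auto
  moreover have "m T dvd A" unfolding A_def using Suc.prems(1)[of T] by (auto intro: dvd_mult2)
  ultimately have lcm: "lcm P (m T) dvd A" by simp
  \<comment> \<open>Stated for index sets \<open>F\<close> rather than initial segments, so that the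
    factors \<open>T - t\<close> stay fixed along the induction.\<close>
  have "gcd P (m T) dvd (\<Prod>t\<in>F. T - t)" if "F \<subseteq> {..<T}" "P = prod m F" for F P
  proof -
    have "finite F" using that(1) finite_subset by blast
    then show ?thesis using that
    proof (induction F arbitrary: P rule: finite_induct)
      case (insert s F)
      have "gcd (m s * prod m F) (m T) dvd gcd (m s) (m T) * gcd (prod m F) (m T)"
        by (rule gcd_mult_dvd)
      also have "\<dots> dvd (T - s) * (\<Prod>t\<in>F. T - t)"
        using insert Suc.prems(2)[of s T] by (intro mult_dvd_mono) auto
      finally show ?case using insert by simp
    qed simp
  qed
  from this[of "{..<T}" P] have "gcd P (m T) dvd (\<Prod>t<T. T - t)" by (simp add: P_def)
  also have "(\<Prod>t<T. T - t) = fact T"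
    using fact_prod_rev[of T, where 'a = nat] by (simp add: atLeast0LessThan)
  finally have "lcm P (m T) * gcd P (m T) dvd A * fact T"
    using lcm by (intro mult_dvd_mono)
  then show ?case
    using prod_gcd_lcm_nat[of P "m T"] by (simp add: P_def A_def mult.assoc mult.commute mult.left_commute)
qed auto

text \<open>The multipliers that make all of \<open>S\<close> integral are closed under taking
  remainders, so the least positive one divides them all. This \<open>d\<close> is the order of the
  tuple \<open>S\<close> modulo the integers.\<close>

lemma integer_multiple_order:
  assumes "q > (0::nat)" "\<forall>z\<in>S. real q * z \<in> \<int>"
  obtains d where "d > 0" "\<And>k::nat. (\<forall>z\<in>S. real k * z \<in> \<int>) \<longleftrightarrow> d dvd k"
proof -
  define P where "P k \<longleftrightarrow> k > 0 \<and> (\<forall>z\<in>S. real k * z \<in> \<int>)" for k :: nat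
  define d where "d = (LEAST k. P k)"
  have Pq: "P q" using assms by (simp add: P_def)
  have Pd: "P d" unfolding d_def by (rule LeastI[of P, OF Pq])
  have "d dvd k" if k: "\<forall>z\<in>S. real k * z \<in> \<int>" for k
  proof (rule ccontr)
    assume "\<not> d dvd k"
    then have "k mod d > 0" by (simp add: mod_greater_zero_iff_not_dvd)
    moreover have "real (k mod d) * z \<in> \<int>" if "z \<in> S" for z
    proof -
      have "real (k mod d) = real k - real (k div d) * real d"
        by (metis add_diff_cancel_left' div_mult_mod_eq of_nat_add of_nat_mult)
      then have "real (k mod d) * z = real k * z - real (k div d) * (real d * z)"
        by (simp only: left_diff_distrib mult.assoc)
      then show ?thesis using k Pd that by (auto simp: P_def intro!: Ints_diff Ints_mult)
    qed
    ultimately have "P (k mod d)" by (simp add: P_def)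
    then have "d \<le> k mod d" unfolding d_def by (rule Least_le)
    then show False using Pd mod_less_divisor[of d k] by (simp add: P_def del: mod_less_divisor)
  qed
  moreover have "real k * z \<in> \<int>" if dk: "d dvd k" and z: "z \<in> S" for k z
  proof -
    obtain j where "k = d * j" using dk by blast
    then have kz: "real k * z = real j * (real d * z)" by simp
    have "real d * z \<in> \<int>" using Pd z by (simp add: P_def)
    then show ?thesis unfolding kz by (rule Ints_mult[OF Ints_of_nat])
  qed
  ultimately show ?thesis using Pd that[of d] by (auto simp: P_def)
qed

text \<open>Let \<open>w\<close> be the order of \<open>(x, y)\<close> modulo the integers and \<open>w / m t\<close> that of \<open>x + t y\<close>. As \<open>(s - t) x\<close>
  and \<open>(s - t) y\<close> are combinations of \<open>x + s y\<close> and \<open>x + t y\<close>, the gcd of \<open>m s\<close> and \<open>m t\<close> divides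
  \<open>s - t\<close>. So the \<open>m t\<close>, all divisors of \<open>w\<close>, are almost coprime, and one of them is small.\<close>

lemma combination_of_two:
  fixes x y :: real and q T :: nat
  assumes "q > 0" "T > 0" "real q * x \<in> \<int>" "real q * y \<in> \<int>"
  obtains t m :: nat where "t < T" "m > 0" "m ^ T \<le> q * (\<Prod>t<T. fact t)"
    "\<And>d::nat. real d * (x + real t * y) \<in> \<int> \<Longrightarrow> real (m * d) * x \<in> \<int> \<and> real (m * d) * y \<in> \<int>"
proof -
  obtain w where w: "w > 0" "\<And>k::nat. (\<forall>z\<in>{x, y}. real k * z \<in> \<int>) \<longleftrightarrow> w dvd k"
    using integer_multiple_order[OF assms(1), of "{x, y}"] assms(3,4) by blast
  have wq: "w dvd q" using assms w(2)[of q] by auto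
  have wxy: "real w * x \<in> \<int>" "real w * y \<in> \<int>" using w(2)[of w] by auto
  have wt: "real w * (x + real t * y) \<in> \<int>" for t
  proof -
    have "real w * (x + real t * y) = real w * x + real t * (real w * y)"
      by (simp add: algebra_simps)
    then show ?thesis using wxy by (auto intro!: Ints_add Ints_mult[OF Ints_of_nat])
  qed
  have "\<exists>d>0. \<forall>k::nat. real k * (x + real t * y) \<in> \<int> \<longleftrightarrow> d dvd k" for t
  proof -
    obtain d where "d > 0" "\<And>k::nat. (\<forall>z\<in>{x + real t * y}. real k * z \<in> \<int>) \<longleftrightarrow> d dvd k"
      using integer_multiple_order[OF w(1), of "{x + real t * y}"] wt[of t] by blast
    then show ?thesis by (intro exI[of _ d]) blast
  qed
  then have "\<forall>t. \<exists>d>0. \<forall>k::nat. real k * (x + real t * y) \<in> \<int> \<longleftrightarrow> d dvd k" by blast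
  from choice[OF this] obtain d where
    d: "\<And>t. d t > 0" "\<And>t k::nat. real k * (x + real t * y) \<in> \<int> \<longleftrightarrow> d t dvd k"
    by blast
  have dw: "d t dvd w" for t using wt d(2) by blast
  define m where "m t = w div d t" for t
  have md: "m t * d t = w" for t using dw by (simp add: m_def)
  have mpos: "m t > 0" for t using md[of t] w(1) by (cases "m t") auto
  have "gcd (m s) (m t) dvd t - s" if "s < t" for s t
  proof -
    define g where "g = gcd (m s) (m t)"
    have gpos: "g > 0" using mpos by (simp add: g_def)
    \<comment> \<open>Both \<open>d s\<close> and \<open>d t\<close> divide
      \<open>v = w / g\<close>, so \<open>v\<close> makes both combinations integral. Then
      \<open>v * (t - s)\<close> is a common denominator of \<open>x\<close> and \<open>y\<close>,
      hence a multiple of \<open>w = v * g\<close>.\<close>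
    define v where "v = w div g"
    have gw: "g dvd w" unfolding g_def by (metis dvd_mult2 gcd_dvd1 md)
    have vg: "v * g = w" using gw by (simp add: v_def)
    have "d t dvd v" if g: "g dvd m t" for t
    proof -
      obtain j where "m t = g * j" using g by blast
      then have "w = g * (d t * j)" using md[of t] by (simp add: mult_ac)
      then show ?thesis using gpos by (simp add: v_def)
    qed
    then have "d s dvd v" "d t dvd v" by (simp_all add: g_def)
    then have Z: "real v * (x + real s * y) \<in> \<int>" "real v * (x + real t * y) \<in> \<int>"
      using d(2) by auto
    have ts: "real (t - s) = real t - real s" using that by simp
    have "real (v * (t - s)) * y = real v * (x + real t * y) - real v * (x + real s * y)"
      by (simp only: of_nat_mult ts) (simp add: algebra_simps)
    moreover have "real (v * (t - s)) * x
        = real t * (real v * (x + real s * y)) - real s * (real v * (x + real t * y))"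
      by (simp only: of_nat_mult ts) (simp add: algebra_simps)
    ultimately have "real (v * (t - s)) * y \<in> \<int>" "real (v * (t - s)) * x \<in> \<int>"
      using Z by (auto intro!: Ints_diff Ints_mult[OF Ints_of_nat])
    then have "v * g dvd v * (t - s)" using w(2)[of "v * (t - s)"] vg by auto
    then show ?thesis using vg w(1) by (auto simp: g_def)
  qed
  then have "(\<Prod>t<T. m t) dvd w * (\<Prod>t<T. fact t)"
    by (intro prod_dvd_of_gcd_dvd_diff) (metis dvd_triv_left md, blast)
  then have le: "(\<Prod>t<T. m t) \<le> w * (\<Prod>t<T. fact t)"
    using w(1) by (intro dvd_imp_le) (auto intro: prod_pos)
  \<comment> \<open>The smallest of the \<open>T\<close> factors is at most their geometric
    mean.\<close>
  define t0 where "t0 = (ARG_MIN m t. t < T)"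
  have t0: "t0 < T" "\<And>t. t < T \<Longrightarrow> m t0 \<le> m t"
    unfolding t0_def using arg_min_nat_lemma[of "\<lambda>t. t < T" 0 m] assms(2) by auto
  have "m t0 ^ T = (\<Prod>t<T. m t0)" by simp
  also have "\<dots> \<le> (\<Prod>t<T. m t)" using t0(2) by (intro prod_mono) auto
  also note le
  also have "w * (\<Prod>t<T. fact t) \<le> q * (\<Prod>t<T. fact t)"
    using wq assms(1) by (intro mult_right_mono dvd_imp_le) auto
  finally have "m t0 ^ T \<le> q * (\<Prod>t<T. fact t)" .
  moreover have "real (m t0 * k) * x \<in> \<int> \<and> real (m t0 * k) * y \<in> \<int>"
    if "real k * (x + real t0 * y) \<in> \<int>" for k :: nat
  proof -
    have "d t0 dvd k" using that d(2) by blast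
    then have "w dvd m t0 * k" by (metis md mult_dvd_mono dvd_refl)
    then show ?thesis using w(2)[of "m t0 * k"] by auto
  qed
  ultimately show ?thesis by (intro that[OF t0(1) mpos])
qed

text \<open>Coordinates are merged one at a time by \<open>combination_of_two\<close>, the partial
  combination taking the role of \<open>x\<close>; the losses \<open>m\<close> multiply. For large
  \<open>T\<close> the bound on \<open>m ^ T\<close> makes \<open>m\<close> at most a constant times
  a small power of \<open>q\<close>.\<close>

lemma combination_of_finitely_many:
  fixes y :: "'a \<Rightarrow> real" and q T :: nat
  assumes "finite S" "q > 0" "T > 0" "\<And>i. i \<in> S \<Longrightarrow> real q * y i \<in> \<int>"
  shows "\<exists>(k :: 'a \<Rightarrow> nat) m. (\<forall>i. k i < T) \<and> m > 0 \<and> m ^ T \<le> (q * (\<Prod>t<T. fact t)) ^ card S \<and>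
    (\<forall>d::nat. real d * (\<Sum>i\<in>S. real (k i) * y i) \<in> \<int> \<longrightarrow> (\<forall>i\<in>S. real (m * d) * y i \<in> \<int>))"
  using assms(1,4)
proof (induction S rule: finite_induct)
  case empty
  show ?case using assms(3) by (intro exI[of _ "\<lambda>_. 0"] exI[of _ 1]) auto
next
  case (insert j S)
  define G where "G = q * (\<Prod>t<T. fact t)"
  obtain k m where k: "\<forall>i. k i < T" and m: "m > 0" "m ^ T \<le> G ^ card S"
    and km: "\<And>d. real d * (\<Sum>i\<in>S. real (k i) * y i) \<in> \<int> \<Longrightarrow> (\<forall>i\<in>S. real (m * d) * y i \<in> \<int>)"
    using insert by (auto simp: G_def)
  define x where "x = (\<Sum>i\<in>S. real (k i) * y i)"
  have "real q * x = (\<Sum>i\<in>S. real (k i) * (real q * y i))"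
    by (simp add: x_def sum_distrib_left mult_ac)
  then have qx: "real q * x \<in> \<int>" using insert.prems
    by (auto intro!: Ints_sum Ints_mult[OF Ints_of_nat insert.prems])
  obtain t m' where t: "t < T" and m': "m' > 0" "m' ^ T \<le> G"
    and tm: "\<And>d::nat. real d * (x + real t * y j) \<in> \<int> \<Longrightarrow>
      real (m' * d) * x \<in> \<int> \<and> real (m' * d) * y j \<in> \<int>"
    using combination_of_two[OF assms(2,3) qx, of "y j"] insert.prems[of j] unfolding G_def by blast
  have sum: "(\<Sum>i\<in>insert j S. real ((k(j := t)) i) * y i) = x + real t * y j"
  proof -
    have "(\<Sum>i\<in>S. real ((k(j := t)) i) * y i) = x"
      unfolding x_def using insert by (intro sum.cong) auto
    then show ?thesis using insert by simp
  qed
  have "real (m * m' * d) * y i \<in> \<int>"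
    if d: "real d * (x + real t * y j) \<in> \<int>" and i: "i \<in> insert j S" for d i
  proof (cases "i = j")
    case True
    have "real (m * m' * d) * y i = real m * (real (m' * d) * y j)" using True by simp
    then show ?thesis using tm[OF d] by (auto intro!: Ints_mult[OF Ints_of_nat] simp del: of_nat_mult)
  next
    case False
    then show ?thesis using km[of "m' * d"] tm[OF d] i by (auto simp: x_def mult.assoc)
  qed
  moreover have "(m * m') ^ T \<le> G ^ card (insert j S)"
    using mult_mono[OF m'(2) m(2)] insert by (simp add: power_mult_distrib mult.commute)
  moreover have k_less: "\<forall>i. (k(j := t)) i < T" using k t by simp
  ultimately show ?case
    using k_less m m' sum unfolding G_def[symmetric]
    by (intro exI[of _ "k(j := t)"] exI[of _ "m * m'"]) (auto simp del: of_nat_mult fun_upd_apply)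
qed

subsection \<open>Torsion points in a small box\<close>

lemma bij_betw_vec_lambda:
  "bij_betw vec_lambda (Pi\<^sub>E UNIV S) {y :: 'a ^ 'n. \<forall>i. y $ i \<in> S i}"
proof (rule bij_betwI[where g = vec_nth])
  show "vec_nth \<in> {y :: 'a ^ 'n. \<forall>i. y $ i \<in> S i} \<rightarrow> Pi\<^sub>E UNIV S" by auto
qed (auto simp: vec_lambda_inverse vec_nth_inverse PiE_def Pi_def)

text \<open>Serves with \<open>f = 1\<close> to count boxes and with one-variable characters to
  factor exponential sums over boxes.\<close>

lemma sum_prod_vec:
  fixes f :: "'n::finite \<Rightarrow> 'a \<Rightarrow> 'b :: comm_semiring_1"
  assumes "\<And>i. finite (S i)"
  shows "(\<Sum>v\<in>{v. \<forall>i. v $ i \<in> S i}. \<Prod>i\<in>UNIV. f i (v $ i)) = (\<Prod>i\<in>UNIV. \<Sum>a\<in>S i. f i a)"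
proof -
  have "(\<Prod>i\<in>UNIV. \<Sum>a\<in>S i. f i a) = (\<Sum>g\<in>Pi\<^sub>E UNIV S. \<Prod>i\<in>UNIV. f i (g i))"
    by (rule prod_sum_PiE) (use assms in auto)
  also have "\<dots> = (\<Sum>v\<in>{v. \<forall>i. v $ i \<in> S i}. \<Prod>i\<in>UNIV. f i (v $ i))"
    using sum.reindex_bij_betw[OF bij_betw_vec_lambda[of S],
        of "\<lambda>v. \<Prod>i\<in>UNIV. f i (v $ i)"] by simp
  finally show ?thesis ..
qed

lemma card_vec_components:
  assumes "\<And>i. finite (S i)"
  shows "card {v :: 'a ^ 'n. \<forall>i. v $ i \<in> S i} = (\<Prod>i\<in>UNIV. card (S i))"
  using sum_prod_vec[OF assms, of "\<lambda>_ _. 1 :: nat"] by simp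

lemma finite_vec_componentwise:
  assumes "\<And>i. finite (S i)"
  shows "finite {v :: 'a ^ 'n. \<forall>i. v $ i \<in> S i}"
  using bij_betw_finite[OF bij_betw_vec_lambda[of S]] assms by (auto intro: finite_PiE)

section \<open>Rationals in short intervals and boxes\<close>

lemma interval_multiples:
  fixes g l :: real and q :: nat
  assumes "q > 0" "l \<ge> 0"
  defines "S \<equiv> {t. g \<le> t \<and> t < g + l \<and> real q * t \<in> \<int>}"
  shows "finite S" "real (card S) \<le> 1 + real q * l"
proof -
  define J where "J = {\<lceil>real q * g\<rceil>..<\<lceil>real q * (g + l)\<rceil>}"
  have sub: "S \<subseteq> (\<lambda>j. real_of_int j / real q) ` J"
  proof
    fix t assume t: "t \<in> S"
    then obtain j where j: "real q * t = real_of_int j" by (auto simp: S_def elim: Ints_cases)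
    have "real q * g \<le> real_of_int j" "real_of_int j < real q * (g + l)"
      unfolding j[symmetric] using t assms(1) by (auto simp: S_def)
    then have "j \<in> J" by (auto simp: J_def ceiling_le_iff less_ceiling_iff)
    moreover have "t = real_of_int j / real q" using j assms(1) by (simp add: field_simps)
    ultimately show "t \<in> (\<lambda>j. real_of_int j / real q) ` J" by blast
  qed
  then show "finite S" by (rule finite_subset) (simp add: J_def)
  have "card S \<le> card J"
    using card_mono[OF _ sub] card_image_le[of J "\<lambda>j. real_of_int j / real q"]
    by (simp add: J_def)
  also have "real (card J) \<le> 1 + real q * l"
  proof -
    have "real q * g \<le> real q * (g + l)" using assms by simp
    then have "\<lceil>real q * g\<rceil> \<le> \<lceil>real q * (g + l)\<rceil>" by (rule ceiling_mono)
    then have "real (card J) = real_of_int \<lceil>real q * (g + l)\<rceil> - real_of_int \<lceil>real q * g\<rceil>"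
      by (simp add: J_def)
    also have "\<dots> \<le> (real q * (g + l) + 1) - real q * g"
      by (intro diff_mono) (auto intro: order_less_imp_le ceiling_correct[THEN conjunct1] simp: le_of_int_ceiling)
    finally show ?thesis by (simp add: algebra_simps)
  qed
  finally show "real (card S) \<le> 1 + real q * l" by simp
qed

lemma box_multiples:
  fixes \<gamma> :: "real ^ 'n" and q :: nat
  assumes "q > 0" "l \<ge> 0"
  defines "A \<equiv> {y :: real ^ 'n. \<forall>i. \<gamma> $ i \<le> y $ i \<and> y $ i < \<gamma> $ i + l \<and> real q * y $ i \<in> \<int>}"
  shows "finite A" "real (card A) \<le> (1 + real q * l) ^ CARD('n)"
proof -
  define S where "S i = {t. \<gamma> $ i \<le> t \<and> t < \<gamma> $ i + l \<and> real q * t \<in> \<int>}" for i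
  have A: "A = {y. \<forall>i. y $ i \<in> S i}" by (simp add: A_def S_def)
  have S: "finite (S i)" "real (card (S i)) \<le> 1 + real q * l" for i
    unfolding S_def using interval_multiples[OF assms(1,2)] by auto
  show "finite A" unfolding A by (rule finite_vec_componentwise[OF S(1)])
  have "real (card A) = (\<Prod>i\<in>UNIV. real (card (S i)))"
    unfolding A card_vec_components[OF S(1)] by simp
  also have "\<dots> \<le> (\<Prod>i\<in>(UNIV::'n set). 1 + real q * l)"
    using S(2) by (intro prod_mono) auto
  finally show "real (card A) \<le> (1 + real q * l) ^ CARD('n)" by simp
qed

text \<open>Cut into half-open bins of length \<open>s\<close>, the interval has at most one point
  of \<open>A\<close> in each bin; the map \<open>f\<close> numbers the bins.\<close>

lemma card_separated_le:
  fixes A :: "real set"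
  assumes "A \<subseteq> {a..a + l}" "s > 0" "l \<ge> 0"
    and sep: "\<And>x y. x \<in> A \<Longrightarrow> y \<in> A \<Longrightarrow> x \<noteq> y \<Longrightarrow> s \<le> \<bar>x - y\<bar>"
  shows "finite A" "real (card A) \<le> 1 + l / s"
proof -
  define f where "f x = \<lfloor>(x - a) / s\<rfloor>" for x
  have inj: "inj_on f A"
  proof (rule inj_onI, rule ccontr)
    fix x y assume xy: "x \<in> A" "y \<in> A" "f x = f y" "x \<noteq> y"
    then have "\<bar>(x - a) / s - (y - a) / s\<bar> < 1" unfolding f_def by linarith
    moreover have "(x - a) / s - (y - a) / s = (x - y) / s" by (simp add: diff_divide_distrib)
    ultimately have "\<bar>x - y\<bar> < s" using assms(2) by (simp add: abs_divide)
    then show False using sep[OF xy(1,2,4)] by simp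
  qed
  have im: "f ` A \<subseteq> {0..\<lfloor>l / s\<rfloor>}"
  proof
    fix z assume "z \<in> f ` A"
    then obtain x where x: "x \<in> A" "z = \<lfloor>(x - a) / s\<rfloor>" by (auto simp: f_def)
    then have "0 \<le> x - a" "x - a \<le> l" using assms(1) by auto
    then have "0 \<le> (x - a) / s" "(x - a) / s \<le> l / s"
      using assms(2) by (auto intro: divide_right_mono)
    then show "z \<in> {0..\<lfloor>l / s\<rfloor>}" unfolding x(2) by (auto intro: floor_mono)
  qed
  show fin: "finite A"
    using inj_on_finite[OF inj im] by simp
  have "card A \<le> card {0..\<lfloor>l / s\<rfloor>}"
    by (rule card_inj_on_le[OF inj im]) simp
  moreover have "0 \<le> l / s" using assms by simp
  then have "\<lfloor>l / s\<rfloor> \<ge> 0" by simp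
  then have "real (card {0..\<lfloor>l / s\<rfloor>}) = 1 + real_of_int \<lfloor>l / s\<rfloor>"
    by (simp only: card_atLeastAtMost_int)
  ultimately have "real (card A) \<le> 1 + real_of_int \<lfloor>l / s\<rfloor>" by linarith
  then show "real (card A) \<le> 1 + l / s" by linarith
qed

text \<open>Multiplied by \<open>p * q\<close>, the difference becomes a nonzero integer.\<close>

lemma rationals_separated:
  fixes x y X :: real and p q :: nat
  assumes "real p * x \<in> \<int>" "real q * y \<in> \<int>" "0 < p" "real p \<le> X" "0 < q" "real q \<le> X" "x \<noteq> y"
  shows "1 / X\<^sup>2 \<le> \<bar>x - y\<bar>"
proof -
  have "real p * real q * (x - y) = real q * (real p * x) - real p * (real q * y)"
    by (simp add: algebra_simps)
  also have "\<dots> \<in> \<int>"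
    by (intro Ints_diff Ints_mult[OF Ints_of_nat assms(1)] Ints_mult[OF Ints_of_nat assms(2)])
  finally have "1 \<le> \<bar>real p * real q * (x - y)\<bar>"
    using assms by (intro Ints_nonzero_abs_ge1) auto
  also have "\<dots> = real p * real q * \<bar>x - y\<bar>" by (simp add: abs_mult)
  also have "\<dots> \<le> X\<^sup>2 * \<bar>x - y\<bar>"
    unfolding power2_eq_square using assms by (intro mult_right_mono mult_mono) auto
  finally show ?thesis using assms by (simp add: field_simps)
qed

lemma interval_rationals:
  fixes X a l :: real
  assumes "X > 0" "l \<ge> 0"
  defines "R \<equiv> {r. a \<le> r \<and> r \<le> a + l \<and> (\<exists>q::nat. 0 < q \<and> real q \<le> X \<and> real q * r \<in> \<int>)}"
  shows "finite R" "real (card R) \<le> 1 + l * X\<^sup>2"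
proof -
  have *: "R \<subseteq> {a..a + l}" "1 / X\<^sup>2 > 0" by (use assms(1) in \<open>auto simp: R_def\<close>)
  have sep: "1 / X\<^sup>2 \<le> \<bar>x - y\<bar>" if "x \<in> R" "y \<in> R" "x \<noteq> y" for x y
    using that rationals_separated[of _ x _ y X] by (auto simp: R_def)
  note card_separated_le[OF * assms(2) sep]
  then show "finite R" "real (card R) \<le> 1 + l * X\<^sup>2" by simp_all
qed

section \<open>Counting torsion points of bounded order in a box\<close>

text \<open>Representatives in real space stand for the points of the torus. A common denominator
  \<open>q \<le> X\<close> amounts to order at most \<open>X\<close>, since the order divides every
  such \<open>q\<close>. The half-open sides match those of \<open>cell\<close>.\<close>

definition torsion_box :: "real \<Rightarrow> real \<Rightarrow> real ^ 'n \<Rightarrow> (real ^ 'n) set"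
  where "torsion_box X l \<gamma> = {y. (\<forall>i. \<gamma> $ i \<le> y $ i \<and> y $ i < \<gamma> $ i + l) \<and>
    (\<exists>q::nat. 0 < q \<and> real q \<le> X \<and> (\<forall>i. real q * y $ i \<in> \<int>))}"

text \<open>Each of the at most \<open>X\<close> denominators \<open>q\<close> contributes at most
  \<open>(1 + q * l) ^ CARD('n)\<close> points, and \<open>1 + q * l \<le> 2 * (X * l)\<close>
  because \<open>X * l \<ge> 1\<close>.\<close>

lemma torsion_box_large:
  fixes \<gamma> :: "real ^ 'n"
  assumes "X \<ge> 1" "l > 0" "X * l \<ge> 1"
  shows "finite (torsion_box X l \<gamma>)"
    "real (card (torsion_box X l \<gamma>)) \<le> 2 ^ CARD('n) * (X ^ (CARD('n) + 1) * l ^ CARD('n))"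
proof -
  define A where "A q = {y :: real ^ 'n. \<forall>i. \<gamma> $ i \<le> y $ i \<and> y $ i < \<gamma> $ i + l \<and> real q * y $ i \<in> \<int>}"
    for q :: nat
  define Q where "Q = {1..nat \<lfloor>X\<rfloor>}"
  have A: "finite (A q)" "real (card (A q)) \<le> (1 + real q * l) ^ CARD('n)" if "q \<in> Q" for q
    unfolding A_def using that assms(2) box_multiples[of q l \<gamma>] by (auto simp: Q_def)
  have sub: "torsion_box X l \<gamma> \<subseteq> (\<Union>q\<in>Q. A q)"
    by (fastforce simp: torsion_box_def A_def Q_def le_nat_floor)
  have fin: "finite (\<Union>q\<in>Q. A q)" using A(1) by (auto simp: Q_def)
  show "finite (torsion_box X l \<gamma>)" by (rule finite_subset[OF sub fin])
  have QX: "real q \<le> X" if "q \<in> Q" for q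
    using that assms(1) by (simp add: Q_def) linarith
  have "card (torsion_box X l \<gamma>) \<le> card (\<Union>q\<in>Q. A q)" by (rule card_mono[OF fin sub])
  also have "\<dots> \<le> (\<Sum>q\<in>Q. card (A q))" by (rule card_UN_le) (simp add: Q_def)
  finally have "real (card (torsion_box X l \<gamma>)) \<le> (\<Sum>q\<in>Q. real (card (A q)))"
    by (metis of_nat_le_iff of_nat_sum)
  also have "\<dots> \<le> (\<Sum>q\<in>Q. (2 * (X * l)) ^ CARD('n))"
  proof (rule sum_mono)
    fix q assume q: "q \<in> Q"
    have "1 + real q * l \<le> 2 * (X * l)"
      using mult_right_mono[OF QX[OF q], of l] assms by linarith
    then show "real (card (A q)) \<le> (2 * (X * l)) ^ CARD('n)"
      using A(2)[OF q] assms by (meson add_nonneg_nonneg dual_order.trans less_imp_le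
        mult_nonneg_nonneg of_nat_0_le_iff power_mono zero_le_one)
  qed
  also have "\<dots> \<le> X * (2 * (X * l)) ^ CARD('n)"
    using assms by (auto simp: Q_def intro!: mult_right_mono)
  finally show "real (card (torsion_box X l \<gamma>)) \<le> 2 ^ CARD('n) * (X ^ (CARD('n) + 1) * l ^ CARD('n))"
    by (simp add: power_mult_distrib mult_ac)
qed

text \<open>The three factors of the bound count the coefficient tuples \<open>k\<close>, the values
  \<open>r\<close> of the combination \<open>h k y\<close>, and, given these, the losses
  \<open>m \<le> M\<close> together with the points of denominator \<open>m * d r\<close> in the
  box.\<close>

lemma torsion_box_small:
  fixes \<gamma> :: "real ^ 'n" and T :: nat
  assumes "X \<ge> 1" "l > 0" "X * l \<le> 1" "T > 0"
  defines "M \<equiv> (X * real (\<Prod>t<T. fact t)) powr (real CARD('n) / real T)"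
  shows "finite (torsion_box X l \<gamma>)"
    "real (card (torsion_box X l \<gamma>))
      \<le> real T ^ CARD('n) * (1 + real CARD('n) * real T * l * X\<^sup>2) * (2 * M) ^ (CARD('n) + 1)"
proof -
  define G where "G = (\<Prod>t<T. fact t :: nat)"
  have G: "G \<ge> 1" unfolding G_def by (intro prod_ge_1) (simp add: fact_ge_1)
  have XG: "1 \<le> X * real G" using mult_mono[of 1 X 1 "real G"] assms(1) G by simp
  have M_ge: "M \<ge> 1" unfolding M_def G_def[symmetric] using XG by (intro ge_one_powr_ge_zero) auto
  \<comment> \<open>\<open>M\<close> is the \<open>T\<close>-th root of the bound on
    \<open>m ^ T\<close> in \<open>combination_of_finitely_many\<close>, with \<open>q\<close>
    replaced by \<open>X\<close>.\<close>
  have M_pow: "M ^ T = (X * real G) ^ CARD('n)"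
  proof -
    have "M ^ T = M powr real T" using M_ge by (simp add: powr_realpow)
    also have "\<dots> = (X * real G) powr real CARD('n)"
      using assms(4) by (simp add: M_def G_def powr_powr)
    also have "\<dots> = (X * real G) ^ CARD('n)" using XG by (simp add: powr_realpow)
    finally show ?thesis .
  qed
  define h :: "('n \<Rightarrow> nat) \<Rightarrow> real ^ 'n \<Rightarrow> real" where "h k y = (\<Sum>i\<in>UNIV. real (k i) * y $ i)" for k y
  define K :: "('n \<Rightarrow> nat) set" where "K = Pi\<^sub>E UNIV (\<lambda>_. {..<T})"
  \<comment> \<open>The coefficients lie between 0 and \<open>T\<close>, so \<open>h k\<close> maps
    the box into an interval of length \<open>b\<close> that starts at
    \<open>h k \<gamma>\<close>.\<close>
  define b where "b = real CARD('n) * real T * l"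
  define R where "R k = {r. h k \<gamma> \<le> r \<and> r \<le> h k \<gamma> + b \<and>
    (\<exists>q::nat. 0 < q \<and> real q \<le> X \<and> real q * r \<in> \<int>)}" for k
  \<comment> \<open>Any admissible denominator will do, as long as it depends on \<open>r\<close>
    alone: then \<open>r\<close> and \<open>m\<close> determine a denominator \<open>m * d r\<close>
    of \<open>y\<close>.\<close>
  define d where "d r = (SOME q::nat. 0 < q \<and> real q \<le> X \<and> real q * r \<in> \<int>)" for r
  have d: "0 < d r" "real (d r) \<le> X" "real (d r) * r \<in> \<int>" if "r \<in> R k" for r k
    using that someI_ex[of "\<lambda>q::nat. 0 < q \<and> real q \<le> X \<and> real q * r \<in> \<int>"]
    by (auto simp: R_def d_def)
  define A where "A q = {y :: real ^ 'n. \<forall>i. \<gamma> $ i \<le> y $ i \<and> y $ i < \<gamma> $ i + l \<and> real q * y $ i \<in> \<int>}"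
    for q :: nat
  define I where "I = {1..nat \<lfloor>M\<rfloor>}"
  have I: "real m \<le> M" "m > 0" if "m \<in> I" for m
    using that M_ge by (simp_all add: I_def) linarith
  have K: "finite K" "card K = T ^ CARD('n)"
    unfolding K_def by (auto intro: finite_PiE simp: card_PiE)
  have b: "b \<ge> 0" using assms by (simp add: b_def)
  have R: "finite (R k)" "real (card (R k)) \<le> 1 + b * X\<^sup>2" for k
    unfolding R_def using interval_rationals[of X b "h k \<gamma>"] assms(1) b by auto
  have A: "finite (A (m * d r))" "real (card (A (m * d r))) \<le> (1 + M) ^ CARD('n)"
    if "m \<in> I" "r \<in> R k" for m r k
  proof -
    have pos: "m * d r > 0" using I(2)[OF that(1)] d(1)[OF that(2)] by simp
    show "finite (A (m * d r))"
      unfolding A_def using box_multiples(1)[OF pos, of l \<gamma>] assms(2) by simp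
    \<comment> \<open>Here the smallness of the box enters: since \<open>d r * l \<le> 1\<close>,
      each coordinate has at most \<open>1 + M\<close> possible values.\<close>
    have "real (d r) * l \<le> X * l" using d(2)[OF that(2)] assms(2) by (simp add: mult_right_mono)
    also note assms(3)
    finally have "real m * (real (d r) * l) \<le> M * 1"
      using I(1)[OF that(1)] M_ge assms(2) by (intro mult_mono) auto
    then have "(1 + real (m * d r) * l) ^ CARD('n) \<le> (1 + M) ^ CARD('n)"
      using assms(2) by (intro power_mono) (auto simp: mult.assoc)
    moreover have "real (card (A (m * d r))) \<le> (1 + real (m * d r) * l) ^ CARD('n)"
      unfolding A_def using box_multiples(2)[OF pos, of l \<gamma>] assms(2) by simp
    ultimately show "real (card (A (m * d r))) \<le> (1 + M) ^ CARD('n)" by linarith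
  qed
  define U where "U = (\<Union>k\<in>K. \<Union>r\<in>R k. \<Union>m\<in>I. A (m * d r))"
  have finI: "finite I" by (simp add: I_def)
  have finU: "finite U" unfolding U_def using K(1) R(1) A(1) finI by blast
  have sub: "torsion_box X l \<gamma> \<subseteq> U"
  proof
    fix y assume y: "y \<in> torsion_box X l \<gamma>"
    then obtain q :: nat where q: "0 < q" "real q \<le> X" "\<And>i. real q * y $ i \<in> \<int>"
      by (auto simp: torsion_box_def)
    have box: "\<gamma> $ i \<le> y $ i" "y $ i < \<gamma> $ i + l" for i using y by (auto simp: torsion_box_def)
    have "\<exists>(k :: 'n \<Rightarrow> nat) m. (\<forall>i. k i < T) \<and> m > 0 \<and> m ^ T \<le> (q * G) ^ CARD('n) \<and>
      (\<forall>d::nat. real d * h k y \<in> \<int> \<longrightarrow> (\<forall>i\<in>UNIV. real (m * d) * y $ i \<in> \<int>))"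
      unfolding h_def G_def
      by (rule combination_of_finitely_many[OF _ q(1) assms(4)]) (use q(3) in auto)
    then obtain k m where k: "\<And>i. k i < T" and m: "m > 0" "m ^ T \<le> (q * G) ^ CARD('n)"
      and km: "\<And>(d::nat) i. real d * h k y \<in> \<int> \<Longrightarrow> real (m * d) * y $ i \<in> \<int>"
      by blast
    have kK: "k \<in> K" using k by (simp add: K_def PiE_def extensional_def)
    have "h k \<gamma> \<le> h k y"
      unfolding h_def using box(1) by (intro sum_mono mult_left_mono) auto
    moreover have "h k y \<le> h k \<gamma> + b"
    proof -
      have "h k y - h k \<gamma> = (\<Sum>i\<in>UNIV. real (k i) * (y $ i - \<gamma> $ i))"
        by (simp add: h_def sum_subtractf right_diff_distrib)
      also have "\<dots> \<le> (\<Sum>i\<in>(UNIV::'n set). real T * l)"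
      proof (rule sum_mono)
        fix i
        have "y $ i - \<gamma> $ i \<le> l" "0 \<le> y $ i - \<gamma> $ i" using box[of i] by auto
        then show "real (k i) * (y $ i - \<gamma> $ i) \<le> real T * l"
          using k[of i] by (intro mult_mono) auto
      qed
      finally show ?thesis by (simp add: b_def)
    qed
    moreover have "real q * h k y = (\<Sum>i\<in>UNIV. real (k i) * (real q * y $ i))"
      by (simp add: h_def sum_distrib_left mult_ac)
    then have "real q * h k y \<in> \<int>"
      by (auto intro!: Ints_sum Ints_mult[OF Ints_of_nat q(3)])
    ultimately have r: "h k y \<in> R k" using q(1,2) by (auto simp: R_def)
    have "real (m ^ T) \<le> real ((q * G) ^ CARD('n))" using m(2) by (simp only: of_nat_le_iff)
    also have "\<dots> \<le> (X * real G) ^ CARD('n)"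
      using q(2) by (simp flip: power_mult_distrib) (intro power_mono mult_right_mono; simp)
    finally have "real m ^ T \<le> M ^ T" by (simp add: M_pow)
    then have "real m \<le> M" using M_ge assms(4) by (subst (asm) power_mono_iff) auto
    then have "m \<in> I" using m(1) by (auto simp: I_def le_nat_floor)
    \<comment> \<open>The chosen denominator makes \<open>h k y\<close> integral, so by
      \<open>km\<close> its multiple by \<open>m\<close> does the same for every coordinate of
      \<open>y\<close>.\<close>
    moreover have "y \<in> A (m * d (h k y))"
      using box km[OF d(3)[OF r]] by (auto simp: A_def)
    ultimately show "y \<in> U" unfolding U_def using kK r by blast
  qed
  show "finite (torsion_box X l \<gamma>)" by (rule finite_subset[OF sub finU])
  have "card U \<le> (\<Sum>k\<in>K. card (\<Union>r\<in>R k. \<Union>m\<in>I. A (m * d r)))"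
    unfolding U_def by (rule card_UN_le[OF K(1)])
  also have "\<dots> \<le> (\<Sum>k\<in>K. \<Sum>r\<in>R k. card (\<Union>m\<in>I. A (m * d r)))"
    by (intro sum_mono card_UN_le R(1))
  also have "\<dots> \<le> (\<Sum>k\<in>K. \<Sum>r\<in>R k. \<Sum>m\<in>I. card (A (m * d r)))"
    by (intro sum_mono card_UN_le finI)
  finally have "card (torsion_box X l \<gamma>) \<le> (\<Sum>k\<in>K. \<Sum>r\<in>R k. \<Sum>m\<in>I. card (A (m * d r)))"
    using card_mono[OF finU sub] by linarith
  then have "real (card (torsion_box X l \<gamma>)) \<le> (\<Sum>k\<in>K. \<Sum>r\<in>R k. \<Sum>m\<in>I. real (card (A (m * d r))))"
    by (simp only: of_nat_le_iff flip: of_nat_sum)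
  also have "\<dots> \<le> (\<Sum>k\<in>K. \<Sum>r\<in>R k. \<Sum>m\<in>I. (1 + M) ^ CARD('n))"
    by (intro sum_mono A(2))
  also have "\<dots> \<le> (\<Sum>k\<in>K. \<Sum>r\<in>R k. M * (1 + M) ^ CARD('n))"
    using M_ge by (intro sum_mono) (auto simp: I_def intro!: mult_right_mono)
  also have "\<dots> \<le> (\<Sum>k\<in>K. \<Sum>r\<in>R k. (2 * M) ^ (CARD('n) + 1))"
  proof (intro sum_mono)
    have "M * (1 + M) ^ CARD('n) \<le> (2 * M) * (2 * M) ^ CARD('n)"
      using M_ge by (intro mult_mono power_mono) auto
    then show "M * (1 + M) ^ CARD('n) \<le> (2 * M) ^ (CARD('n) + 1)" by simp
  qed
  also have "\<dots> \<le> (\<Sum>k\<in>K. (1 + b * X\<^sup>2) * (2 * M) ^ (CARD('n) + 1))"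
  proof (rule sum_mono)
    fix k
    have "(\<Sum>r\<in>R k. (2 * M) ^ (CARD('n) + 1)) = real (card (R k)) * (2 * M) ^ (CARD('n) + 1)"
      by (rule sum_constant)
    also have "\<dots> \<le> (1 + b * X\<^sup>2) * (2 * M) ^ (CARD('n) + 1)"
      using M_ge by (intro mult_right_mono R(2)) auto
    finally show "(\<Sum>r\<in>R k. (2 * M) ^ (CARD('n) + 1)) \<le> (1 + b * X\<^sup>2) * (2 * M) ^ (CARD('n) + 1)" .
  qed
  also have "\<dots> = real T ^ CARD('n) * (1 + b * X\<^sup>2) * (2 * M) ^ (CARD('n) + 1)"
    by (simp add: K(2))
  finally show "real (card (torsion_box X l \<gamma>))
      \<le> real T ^ CARD('n) * (1 + real CARD('n) * real T * l * X\<^sup>2) * (2 * M) ^ (CARD('n) + 1)"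
    by (simp add: b_def)
qed

lemma card_torsion_box_le:
  fixes \<epsilon> :: real
  assumes "\<epsilon> > 0"
  obtains C where "C > 0" "\<And>X l (\<gamma> :: real ^ 'n). X \<ge> 1 \<Longrightarrow> l > 0 \<Longrightarrow> finite (torsion_box X l \<gamma>) \<and>
    real (card (torsion_box X l \<gamma>))
      \<le> C * X powr \<epsilon> * (X ^ (CARD('n) + 1) * l ^ CARD('n) + X\<^sup>2 * l + 1)"
proof -
  let ?n = "CARD('n)"
  \<comment> \<open>With this \<open>T\<close> the exponent of \<open>M ^ (?n + 1)\<close> as a
    power of \<open>X * G\<close> is at most \<open>\<epsilon>\<close>; the part coming from
    \<open>G\<close> depends only on the dimension and \<open>\<epsilon>\<close> and goes into
    \<open>C\<close>.\<close>
  define T where "T = nat \<lceil>real ?n * real (?n + 1) / \<epsilon>\<rceil>"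
  have T: "real ?n * real (?n + 1) / \<epsilon> \<le> real T" unfolding T_def by linarith
  moreover have "real ?n * real (?n + 1) / \<epsilon> > 0" using assms by simp
  ultimately have "real T > 0" by linarith
  then have T0: "T > 0" by simp
  have T\<epsilon>: "real ?n / real T * real (?n + 1) \<le> \<epsilon>"
    using T assms T0 by (simp add: field_simps)
  define G where "G = real (\<Prod>t<T. fact t)"
  have G: "G \<ge> 1" unfolding G_def by (simp add: prod_ge_1)
  \<comment> \<open>The first summand serves the case \<open>X * l \<ge> 1\<close>, the second the
    case \<open>X * l < 1\<close>.\<close>
  define C where "C = 2 ^ ?n + real T ^ ?n * (real ?n * real T) * (2 ^ (?n + 1) * G powr \<epsilon>)"
  \<comment> \<open>Allows the summand 1 in the count of \<open>torsion_box_small\<close> to be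
    absorbed when \<open>?n * T\<close> is factored out.\<close>
  have nT: "real ?n * real T \<ge> 1"
    using T0 by (metis One_nat_def Suc_leI mult_eq_1_iff nat_0_less_mult_iff of_nat_1 of_nat_le_iff of_nat_mult zero_less_card_finite)
  have C: "C > 0" unfolding C_def by (intro add_pos_nonneg) auto
  have C1: "2 ^ ?n \<le> C" unfolding C_def by (simp add: mult_nonneg_nonneg)
  have C2: "real T ^ ?n * (real ?n * real T) * (2 ^ (?n + 1) * G powr \<epsilon>) \<le> C"
    unfolding C_def by simp
  have "finite (torsion_box X l \<gamma>) \<and> real (card (torsion_box X l \<gamma>))
      \<le> C * X powr \<epsilon> * (X ^ (?n + 1) * l ^ ?n + X\<^sup>2 * l + 1)" if X: "X \<ge> 1" and l: "l > 0"
    for X l and \<gamma> :: "real ^ 'n"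
  proof (cases "X * l \<ge> 1")
    case True
    note torsion_box_large[OF X l True, of \<gamma>]
    moreover have "2 ^ ?n * (X ^ (?n + 1) * l ^ ?n)
        \<le> (C * X powr \<epsilon>) * (X ^ (?n + 1) * l ^ ?n + X\<^sup>2 * l + 1)"
    proof (rule mult_mono)
      have "C * 1 \<le> C * X powr \<epsilon>"
        using C assms X by (intro mult_left_mono ge_one_powr_ge_zero) auto
      then show "2 ^ ?n \<le> C * X powr \<epsilon>" using C1 by simp
    qed (use X l C in auto)
    ultimately show ?thesis by linarith
  next
    case False
    define M where "M = (X * G) powr (real ?n / real T)"
    have XG: "1 \<le> X * G" using mult_mono[of 1 X 1 G] X G by simp
    have M0: "M > 0" using XG by (auto simp: M_def)
    have "M ^ (?n + 1) = M powr real (?n + 1)" using M0 by (simp only: powr_realpow)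
    also have "\<dots> = (X * G) powr (real ?n / real T * real (?n + 1))"
      by (simp only: M_def powr_powr)
    also have "\<dots> \<le> (X * G) powr \<epsilon>" using XG T\<epsilon> by (rule powr_mono[rotated])
    also have "\<dots> = X powr \<epsilon> * G powr \<epsilon>" using X G by (simp add: powr_mult)
    finally have M_le: "(2 * M) ^ (?n + 1) \<le> 2 ^ (?n + 1) * (X powr \<epsilon> * G powr \<epsilon>)"
      unfolding power_mult_distrib by (rule mult_left_mono) simp
    have fin: "finite (torsion_box X l \<gamma>)" and "real (card (torsion_box X l \<gamma>))
        \<le> real T ^ ?n * (1 + real ?n * real T * l * X\<^sup>2) * (2 * M) ^ (?n + 1)"
      using torsion_box_small[OF X l _ T0, of \<gamma>] False by (simp_all add: M_def G_def)
    note this(2)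
    also have "real T ^ ?n * (1 + real ?n * real T * l * X\<^sup>2) * (2 * M) ^ (?n + 1)
      \<le> real T ^ ?n * ((real ?n * real T) * (X ^ (?n + 1) * l ^ ?n + X\<^sup>2 * l + 1))
        * (2 ^ (?n + 1) * (X powr \<epsilon> * G powr \<epsilon>))"
    proof (intro mult_mono mult_left_mono M_le)
      have "real ?n * real T * (X ^ (?n + 1) * l ^ ?n) \<ge> 0" using X l by simp
      then show "1 + real ?n * real T * l * X\<^sup>2
          \<le> (real ?n * real T) * (X ^ (?n + 1) * l ^ ?n + X\<^sup>2 * l + 1)"
        using nT by (simp add: distrib_left mult.assoc mult.commute mult.left_commute)
      show "0 \<le> real T ^ ?n * (real ?n * real T * (X ^ (?n + 1) * l ^ ?n + X\<^sup>2 * l + 1))"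
        using X l by (intro mult_nonneg_nonneg add_nonneg_nonneg) auto
    qed (use M0 l in \<open>auto intro: add_nonneg_nonneg\<close>)
    also have "\<dots> = (real T ^ ?n * (real ?n * real T) * (2 ^ (?n + 1) * G powr \<epsilon>)) * (X powr \<epsilon>
        * (X ^ (?n + 1) * l ^ ?n + X\<^sup>2 * l + 1))"
      by (simp only: mult_ac)
    also have "\<dots> \<le> C * (X powr \<epsilon> * (X ^ (?n + 1) * l ^ ?n + X\<^sup>2 * l + 1))"
      using X l by (intro mult_right_mono C2) auto
    finally show ?thesis using fin by (simp only: mult.assoc)
  qed
  then show ?thesis using C that by blast
qed

subsection \<open>The large sieve\<close>

text \<open>Jordan's inequality: the concave sine lies above its chord from 0 to
  \<open>pi / 2\<close>.\<close>

lemma sin_pi_ge: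
  assumes "0 \<le> y" "y \<le> 1 / 2"
  shows "2 * y \<le> sin (pi * y)"
proof -
  have "concave_on {0..pi} sin"
    by (rule f''_le0_imp_concave[where f' = cos and f'' = "\<lambda>x. - sin x"])
      (auto intro!: derivative_eq_intros sin_ge_zero)
  then have "(1 - 2 * y) * sin 0 + 2 * y * sin (pi / 2) \<le> sin ((1 - 2 * y) *\<^sub>R 0 + (2 * y) *\<^sub>R (pi / 2))"
    using assms by (intro concave_onD) auto
  then show ?thesis by (simp add: mult.commute)
qed

text \<open>A geometric sum, kept free of division so that integral \<open>\<theta>\<close> is no
  exception.\<close>

lemma cis_sum_telescope:
  fixes a b :: int
  assumes "a \<le> b"
  shows "(1 - cis (2 * pi * \<theta>)) * (\<Sum>m\<in>{a..<b}. cis (2 * pi * (of_int m * \<theta>)))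
    = cis (2 * pi * (of_int a * \<theta>)) - cis (2 * pi * (of_int b * \<theta>))"
  using assms
proof (induction b rule: int_ge_induct)
  case (step b)
  define u f where "u = cis (2 * pi * \<theta>)" and "f m = cis (2 * pi * (of_int m * \<theta>))" for m :: int
  have "{a..<b + 1} = insert b {a..<b}" using step.hyps by auto
  then have "sum f {a..<b + 1} = f b + sum f {a..<b}" by simp
  moreover have "f (b + 1) = u * f b"
    by (simp add: u_def f_def cis_mult algebra_simps)
  moreover have "(1 - u) * sum f {a..<b} = f a - f b" using step.IH by (simp add: u_def f_def)
  ultimately have "(1 - u) * sum f {a..<b + 1} = f a - f (b + 1)" by (simp add: distrib_left left_diff_distrib)
  then show ?case by (simp add: u_def f_def)
qed simp

text \<open>The circle of reals modulo 1 is cut into \<open>L\<close> half-open arcs of length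
  \<open>1 / L\<close>; this is the number of the arc that contains \<open>\<theta>\<close>.\<close>

definition cell :: "nat \<Rightarrow> real \<Rightarrow> nat"
  where "cell L \<theta> = nat \<lfloor>real L * frac \<theta>\<rfloor>"

lemma cell_bounds:
  assumes "L > 0"
  shows "cell L \<theta> < L" "real (cell L \<theta>) \<le> real L * frac \<theta>" "real L * frac \<theta> < real (cell L \<theta>) + 1"
proof -
  have nn: "0 \<le> real L * frac \<theta>" by simp
  have "real L * frac \<theta> < real L * 1"
    using assms frac_lt_1[of \<theta>] by (intro mult_strict_left_mono) auto
  then show "cell L \<theta> < L" unfolding cell_def using nn assms by (simp add: nat_less_iff floor_less_iff)
  show "real (cell L \<theta>) \<le> real L * frac \<theta>" "real L * frac \<theta> < real (cell L \<theta>) + 1"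
    unfolding cell_def using nn by linarith+
qed

text \<open>The cells are numbered cyclically, so the distance of \<open>\<theta>\<close> to the integers is about
  \<open>min j (L - 1 - j) / L\<close> on the \<open>j\<close>-th cell.\<close>

definition decay :: "nat \<Rightarrow> nat \<Rightarrow> real"
  where "decay L j = 1 / (1 + real (min j (L - 1 - j)))"

text \<open>The telescoped sum has norm at most 2, while the factor
  \<open>1 - cis (2 * pi * \<theta>)\<close> has norm at least 4 times the distance of
  \<open>\<theta>\<close> to the integers, by Jordan's inequality. On the cells next to the integers
  the trivial bound \<open>L\<close> suffices.\<close>

lemma norm_cis_sum_le:
  fixes a b :: int
  assumes "a \<le> b" "b - a \<le> int L" "L > 0"
  shows "cmod (\<Sum>m\<in>{a..<b}. cis (2 * pi * (of_int m * \<theta>))) \<le> real L * decay L (cell L \<theta>)"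
proof -
  define D where "D = (\<Sum>m\<in>{a..<b}. cis (2 * pi * (of_int m * \<theta>)))"
  define y where "y = frac \<theta>"
  define j \<mu> where "j = cell L \<theta>" and "\<mu> = min j (L - 1 - j)"
  have triv: "cmod D \<le> real L"
  proof -
    have "cmod D \<le> (\<Sum>m\<in>{a..<b}. cmod (cis (2 * pi * (of_int m * \<theta>))))"
      unfolding D_def by (rule norm_sum)
    also have "\<dots> = real (nat (b - a))" by simp
    also have "\<dots> \<le> real L" using assms by linarith
    finally show ?thesis .
  qed
  show ?thesis
  proof (cases "\<mu> = 0")
    case True
    then show ?thesis using triv by (simp add: decay_def D_def j_def \<mu>_def)
  next
    case False
    note cb = cell_bounds[OF assms(3), of \<theta>, folded j_def y_def]
    have y: "0 \<le> y" "y < 1" by (auto simp: y_def frac_lt_1)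
    have "real \<mu> \<le> real L * y" using cb by (simp add: \<mu>_def)
    moreover have "real \<mu> \<le> real L * (1 - y)"
      using cb by (simp add: \<mu>_def algebra_simps of_nat_diff)
    ultimately have \<mu>: "real \<mu> / real L \<le> y" "real \<mu> / real L \<le> 1 - y"
      using assms(3) by (simp_all add: field_simps)
    have sin: "2 * (real \<mu> / real L) \<le> sin (pi * y)"
    proof (cases "y \<le> 1 / 2")
      case True
      then show ?thesis using sin_pi_ge[OF y(1)] \<mu> by linarith
    next
      case False
      have "sin (pi * (1 - y)) = sin (pi * y)" by (simp add: right_diff_distrib)
      then show ?thesis using sin_pi_ge[of "1 - y"] y \<mu> False by simp
    qed
    have "cis (2 * pi * \<theta>) = cis (2 * pi * y + 2 * pi * of_int \<lfloor>\<theta>\<rfloor>)"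
      by (simp add: y_def frac_def algebra_simps)
    also have "\<dots> = cis (2 * pi * y)"
      by (simp add: cis_mult[symmetric] cis_multiple_2pi)
    finally have "cmod (1 - cis (2 * pi * \<theta>)) = 2 * \<bar>sin (pi * y)\<bar>"
      using dist_exp_i_1[of "2 * pi * y"] by (simp add: cis_conv_exp norm_minus_commute)
    then have "4 * (real \<mu> / real L) * cmod D \<le> cmod (1 - cis (2 * pi * \<theta>)) * cmod D"
      using sin by (intro mult_right_mono) auto
    also have "\<dots> = cmod (cis (2 * pi * (of_int a * \<theta>)) - cis (2 * pi * (of_int b * \<theta>)))"
      unfolding cis_sum_telescope[OF assms(1), symmetric] D_def by (simp add: norm_mult)
    also have "\<dots> \<le> 2"
      using norm_triangle_ineq4[of "cis (2 * pi * (of_int a * \<theta>))" "cis (2 * pi * (of_int b * \<theta>))"] by simp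
    finally have "(2 * real \<mu>) * cmod D \<le> real L"
      using assms(3) by (simp add: field_simps)
    \<comment> \<open>As \<open>\<mu> \<ge> 1\<close> in this case, \<open>2 * \<mu>\<close> may be
      weakened to \<open>1 + \<mu>\<close>, the form that also covers
      \<open>\<mu> = 0\<close>.\<close>
    moreover have "(1 + real \<mu>) * cmod D \<le> (2 * real \<mu>) * cmod D"
      using False by (intro mult_right_mono) auto
    ultimately have "(1 + real \<mu>) * cmod D \<le> real L" by linarith
    then have "cmod D \<le> real L * (1 / (1 + real \<mu>))" by (simp add: field_simps)
    then show ?thesis by (simp only: decay_def D_def j_def \<mu>_def)
  qed
qed

text \<open>Each term is at most the sum of one term decaying from the left end and one from the
  right end; reflection makes both sums equal, and each is at most 2.\<close>

lemma sum_decay_le: "(\<Sum>j<L. (decay L j)\<^sup>2) \<le> 4"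
proof -
  \<comment> \<open>The term \<open>- 1 / real L\<close> makes the induction telescope. For
    \<open>L = 0\<close> it is 0 by the convention on division, and so the passage from 0 to 1 is
    treated apart.\<close>
  have basel: "(\<Sum>j<L. 1 / (1 + real j)\<^sup>2) \<le> 2 - 1 / real L" for L
  proof (induction L)
    case (Suc L)
    have "1 / (1 + real L)\<^sup>2 \<le> 1 / real L - 1 / (1 + real L)" if "L > 0"
    proof -
      have "1 / (1 + real L)\<^sup>2 \<le> 1 / (real L * (1 + real L))"
        using that by (intro divide_left_mono) (auto simp: power2_eq_square)
      also have "\<dots> = 1 / real L - 1 / (1 + real L)"
        using that by (simp add: field_simps)
      finally show ?thesis .
    qed
    then have "2 - 1 / real L + 1 / (1 + real L)\<^sup>2 \<le> 2 - 1 / (1 + real L)" if "L > 0"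
      using that by simp
    then show ?case using Suc.IH by (cases "L = 0") (auto simp: add.commute)
  qed simp
  have le: "(decay L j)\<^sup>2 \<le> 1 / (1 + real j)\<^sup>2 + 1 / (1 + real (L - Suc j))\<^sup>2" if "j < L" for j
    using that by (simp add: decay_def min_def power_one_over)
  have "(\<Sum>j<L. (decay L j)\<^sup>2) \<le> (\<Sum>j<L. 1 / (1 + real j)\<^sup>2) + (\<Sum>j<L. 1 / (1 + real (L - Suc j))\<^sup>2)"
    unfolding sum.distrib[symmetric] using le by (intro sum_mono) auto
  also have "(\<Sum>j<L. 1 / (1 + real (L - Suc j))\<^sup>2) = (\<Sum>j<L. 1 / (1 + real j)\<^sup>2)"
    by (rule sum.nat_diff_reindex)
  also have "(\<Sum>j<L. 1 / (1 + real j)\<^sup>2) \<le> 2"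
    using basel[of L] by (smt (verit) divide_nonneg_nonneg of_nat_0_le_iff)
  finally show ?thesis by simp
qed

section \<open>Duality and Schur's test\<close>

text \<open>A matrix and its transpose have the same operator norm. With
  \<open>b p = cnj (s p)\<close> the sum \<open>S\<close> becomes the pairing of \<open>c\<close>
  with \<open>t\<close>; Cauchy-Schwarz and \<open>dual\<close> bound \<open>S\<^sup>2\<close> by
  \<open>D * S\<close> times the sum of the squares of \<open>cmod (c \<alpha>)\<close>, and
  \<open>S\<close> cancels.\<close>

lemma duality_principle:
  fixes k :: "'a \<Rightarrow> 'p \<Rightarrow> complex"
  assumes "D \<ge> 0"
    and dual: "\<And>b. (\<Sum>\<alpha>\<in>A. (cmod (\<Sum>p\<in>P. b p * k \<alpha> p))\<^sup>2) \<le> D * (\<Sum>p\<in>P. (cmod (b p))\<^sup>2)"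
  shows "(\<Sum>p\<in>P. (cmod (\<Sum>\<alpha>\<in>A. c \<alpha> * k \<alpha> p))\<^sup>2) \<le> D * (\<Sum>\<alpha>\<in>A. (cmod (c \<alpha>))\<^sup>2)"
proof -
  define s where "s p = (\<Sum>\<alpha>\<in>A. c \<alpha> * k \<alpha> p)" for p
  define t where "t \<alpha> = (\<Sum>p\<in>P. cnj (s p) * k \<alpha> p)" for \<alpha>
  define S where "S = (\<Sum>p\<in>P. (cmod (s p))\<^sup>2)"
  have S0: "S \<ge> 0" by (auto simp: S_def intro: sum_nonneg)
  have "complex_of_real S = (\<Sum>p\<in>P. cnj (s p) * s p)"
    by (simp only: S_def of_real_sum complex_norm_square mult.commute)
  also have "\<dots> = (\<Sum>p\<in>P. \<Sum>\<alpha>\<in>A. c \<alpha> * (cnj (s p) * k \<alpha> p))"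
    by (subst (2) s_def) (simp add: sum_distrib_left mult_ac)
  also have "\<dots> = (\<Sum>\<alpha>\<in>A. c \<alpha> * t \<alpha>)"
    by (subst sum.swap) (simp add: t_def sum_distrib_left)
  finally have "S = cmod (\<Sum>\<alpha>\<in>A. c \<alpha> * t \<alpha>)"
    using S0 by (metis abs_of_nonneg norm_of_real)
  also have "\<dots> \<le> (\<Sum>\<alpha>\<in>A. cmod (c \<alpha>) * cmod (t \<alpha>))"
    by (rule sum_norm_le) (simp add: norm_mult)
  finally have "S\<^sup>2 \<le> (\<Sum>\<alpha>\<in>A. cmod (c \<alpha>) * cmod (t \<alpha>))\<^sup>2"
    using S0 by (rule power_mono)
  also have "\<dots> \<le> (\<Sum>\<alpha>\<in>A. (cmod (c \<alpha>))\<^sup>2) * (\<Sum>\<alpha>\<in>A. (cmod (t \<alpha>))\<^sup>2)"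
    by (rule Cauchy_Schwarz_ineq_sum)
  also have "\<dots> \<le> (\<Sum>\<alpha>\<in>A. (cmod (c \<alpha>))\<^sup>2) * (D * S)"
    using dual[of "\<lambda>p. cnj (s p)"] by (intro mult_left_mono) (auto simp: t_def S_def intro: sum_nonneg)
  finally have SS: "S * S \<le> (D * (\<Sum>\<alpha>\<in>A. (cmod (c \<alpha>))\<^sup>2)) * S"
    by (simp add: power2_eq_square mult_ac)
  have "S \<le> D * (\<Sum>\<alpha>\<in>A. (cmod (c \<alpha>))\<^sup>2)"
  proof (cases "S = 0")
    case False
    with S0 SS show ?thesis by simp
  qed (use assms(1) in \<open>auto intro!: mult_nonneg_nonneg sum_nonneg\<close>)
  then show ?thesis by (simp add: S_def s_def)
qed

text \<open>By \<open>2 * u p * u q \<le> (u p)\<^sup>2 + (u q)\<^sup>2\<close> and the symmetry of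
  \<open>w\<close>, both halves of the double sum reduce to row sums.\<close>

lemma schur_test:
  fixes u :: "'p \<Rightarrow> real" and w :: "'p \<Rightarrow> 'p \<Rightarrow> real"
  assumes "\<And>p q. w p q = w q p" "\<And>p q. w p q \<ge> 0" "\<And>p. p \<in> P \<Longrightarrow> (\<Sum>q\<in>P. w p q) \<le> R"
  shows "(\<Sum>p\<in>P. \<Sum>q\<in>P. u p * u q * w p q) \<le> R * (\<Sum>p\<in>P. (u p)\<^sup>2)"
proof -
  have "(\<Sum>p\<in>P. \<Sum>q\<in>P. u p * u q * w p q)
      \<le> (\<Sum>p\<in>P. \<Sum>q\<in>P. ((u p)\<^sup>2 * w p q + (u q)\<^sup>2 * w q p) / 2)"
  proof (intro sum_mono)
    fix p q
    have "2 * (u p * u q) * w p q \<le> ((u p)\<^sup>2 + (u q)\<^sup>2) * w p q"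
      using sum_squares_bound[of "u p" "u q"] assms(2) by (intro mult_right_mono) auto
    then show "u p * u q * w p q \<le> ((u p)\<^sup>2 * w p q + (u q)\<^sup>2 * w q p) / 2"
      using assms(1)[of p q] by (simp add: algebra_simps)
  qed
  also have "\<dots> = ((\<Sum>p\<in>P. \<Sum>q\<in>P. (u p)\<^sup>2 * w p q) + (\<Sum>p\<in>P. \<Sum>q\<in>P. (u q)\<^sup>2 * w q p)) / 2"
    by (simp add: sum.distrib flip: sum_divide_distrib)
  also have "(\<Sum>p\<in>P. \<Sum>q\<in>P. (u q)\<^sup>2 * w q p) = (\<Sum>p\<in>P. \<Sum>q\<in>P. (u p)\<^sup>2 * w p q)"
    by (rule sum.swap)
  also have "(X + X) / 2 = X" for X :: real by simp
  also have "(\<Sum>p\<in>P. \<Sum>q\<in>P. (u p)\<^sup>2 * w p q) = (\<Sum>p\<in>P. (u p)\<^sup>2 * (\<Sum>q\<in>P. w p q))"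
    by (simp add: sum_distrib_left)
  also have "\<dots> \<le> (\<Sum>p\<in>P. (u p)\<^sup>2 * R)"
    using assms(3) by (intro sum_mono mult_left_mono) auto
  finally show ?thesis by (simp add: sum_distrib_left mult.commute)
qed

section \<open>Characters and the dual large sieve inequality\<close>

text \<open>The counterpart of \<open>torus_char\<close> on representatives; see
  \<open>torus_char_eq_vec_char\<close>.\<close>

definition vec_char :: "int ^ 'n \<Rightarrow> real ^ 'n \<Rightarrow> complex"
  where "vec_char \<alpha> y = cis (2 * pi * (of_int_vec \<alpha> \<bullet> y))"

lemma vec_char_prod:
  fixes y :: "real ^ 'n"
  shows "vec_char \<alpha> y = (\<Prod>i\<in>UNIV. cis (2 * pi * (of_int (\<alpha> $ i) * y $ i)))"
proof -
  have "cis (\<Sum>i\<in>S. f i) = (\<Prod>i\<in>S. cis (f i))" if "finite S" for S :: "'n set" and f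
    using that by (induction S rule: finite_induct) (auto simp: cis_mult[symmetric])
  from this[of UNIV] show ?thesis
    by (simp add: vec_char_def inner_vec_def of_int_vec_def sum_distrib_left)
qed

lemma vec_char_diff_right: "vec_char \<alpha> (y - z) = vec_char \<alpha> y * cnj (vec_char \<alpha> z)"
  by (simp add: vec_char_def inner_diff_right right_diff_distrib cis_cnj cis_mult)

lemma vec_char_diff_left: "vec_char (\<alpha> - \<alpha>') y = vec_char \<alpha> y * cnj (vec_char \<alpha>' y)"
proof -
  have "of_int_vec (\<alpha> - \<alpha>') = of_int_vec \<alpha> - of_int_vec \<alpha>'"
    by (simp add: of_int_vec_def vec_eq_iff)
  then show ?thesis
    by (simp add: vec_char_def inner_diff_left right_diff_distrib cis_cnj cis_mult)
qed

lemma norm_vec_char_sum_le: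
  fixes \<theta> :: "real ^ 'n" and a b :: int
  assumes "a \<le> b" "b - a \<le> int L" "L > 0"
  shows "cmod (\<Sum>v\<in>{v. \<forall>i. v $ i \<in> {a..<b}}. vec_char v \<theta>) \<le> (\<Prod>i\<in>UNIV. real L * decay L (cell L (\<theta> $ i)))"
proof -
  have "(\<Sum>v\<in>{v. \<forall>i. v $ i \<in> {a..<b}}. vec_char v \<theta>)
      = (\<Prod>i\<in>UNIV. \<Sum>m\<in>{a..<b}. cis (2 * pi * (of_int m * \<theta> $ i)))"
    unfolding vec_char_prod by (rule sum_prod_vec) simp
  then show ?thesis
    using norm_cis_sum_le[OF assms] by (simp add: prod_norm[symmetric]) (intro prod_mono; simp)
qed

text \<open>The box \<open>{- Z..Z}\<close> translated by any \<open>w\<close> in \<open>{Z..<2 Z}\<close> stays inside \<open>{0..<3 Z}\<close>. Averaging over \<open>w\<close>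
  replaces the Dirichlet kernel of the box by a product of two Dirichlet kernels, which decays like
  the square of the distance to the integers and hence is summable over the cells.\<close>

lemma large_sieve_dual:
  fixes x :: "'p \<Rightarrow> real ^ 'n" and Z :: nat and b :: "'p \<Rightarrow> complex"
  assumes P: "finite P" and Z: "Z > 0" and K: "K \<ge> 0"
    and cells: "\<And>p j. p \<in> P \<Longrightarrow>
      real (card {q \<in> P. \<forall>i. cell (3 * Z) (x q $ i - x p $ i) = j $ i}) \<le> K"
  shows "(\<Sum>\<alpha>\<in>{\<alpha>. \<forall>i. \<alpha> $ i \<in> {- int Z..int Z}}. (cmod (\<Sum>p\<in>P. b p * vec_char \<alpha> (x p)))\<^sup>2)
    \<le> ((36 * real Z) ^ CARD('n) * K) * (\<Sum>p\<in>P. (cmod (b p))\<^sup>2)"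
proof -
  define L where "L = 3 * Z"
  define F where "F \<alpha> = (\<Sum>p\<in>P. b p * vec_char \<alpha> (x p))" for \<alpha>
  define B M M' :: "(int ^ 'n) set" where "B = {\<alpha>. \<forall>i. \<alpha> $ i \<in> {- int Z..int Z}}"
    and "M = {v. \<forall>i. v $ i \<in> {0..<int L}}" and "M' = {v. \<forall>i. v $ i \<in> {int Z..<2 * int Z}}"
  have fin: "finite B" "finite M" "finite M'"
    unfolding B_def M_def M'_def by (rule finite_vec_componentwise; simp)+
  have cardM': "card M' = Z ^ CARD('n)"
    unfolding M'_def by (subst card_vec_components) auto
  have shift: "(\<Sum>\<alpha>\<in>B. (cmod (F \<alpha>))\<^sup>2) \<le> (\<Sum>v\<in>M. (cmod (F (v - w)))\<^sup>2)" if w: "w \<in> M'" for w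
  proof -
    have "(\<Sum>\<alpha>\<in>B. (cmod (F \<alpha>))\<^sup>2) = (\<Sum>v\<in>(\<lambda>\<alpha>. \<alpha> + w) ` B. (cmod (F (v - w)))\<^sup>2)"
      by (subst sum.reindex) (auto simp: inj_on_def)
    also have "\<dots> \<le> (\<Sum>v\<in>M. (cmod (F (v - w)))\<^sup>2)"
    proof (rule sum_mono2[OF fin(2)])
      show "(\<lambda>\<alpha>. \<alpha> + w) ` B \<subseteq> M"
      proof clarify
        fix \<alpha> assume "\<alpha> \<in> B"
        then have "- int Z \<le> \<alpha> $ i" "\<alpha> $ i \<le> int Z" "int Z \<le> w $ i" "w $ i < 2 * int Z" for i
          using w by (auto simp: B_def M'_def)
        moreover have "int L = 3 * int Z" by (simp add: L_def)
        ultimately have "0 \<le> \<alpha> $ i + w $ i" "\<alpha> $ i + w $ i < int L" for i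
          by (smt (verit))+
        then show "\<alpha> + w \<in> M" by (simp add: M_def)
      qed
    qed auto
    finally show ?thesis .
  qed
  define k where "k \<theta> = (\<Sum>v\<in>M. vec_char v \<theta>) * cnj (\<Sum>w\<in>M'. vec_char w \<theta>)" for \<theta>
  define W where "W p q = cmod (k (x q - x p))" for p q
  have k_minus: "k (- \<theta>) = cnj (k \<theta>)" for \<theta>
    using vec_char_diff_right[of _ 0 \<theta>] by (simp add: k_def vec_char_def)
  have W_sym: "W p q = W q p" for p q
    unfolding W_def using k_minus[of "x q - x p"] by simp
  have expand: "complex_of_real ((cmod (F (v - w)))\<^sup>2)
      = (\<Sum>p\<in>P. \<Sum>q\<in>P. b p * cnj (b q) * (vec_char v (x p - x q) * cnj (vec_char w (x p - x q))))" for v w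
    unfolding complex_norm_square F_def cnj_sum sum_product
    by (intro sum.cong refl) (simp add: vec_char_diff_left vec_char_diff_right mult_ac)
  \<comment> \<open>Once the squares are expanded and the sums over \<open>P\<close> moved outside,
    the sums over \<open>v\<close> and \<open>w\<close> separate and their product is
    \<open>k (x p - x q)\<close>.\<close>
  have "complex_of_real (\<Sum>w\<in>M'. \<Sum>v\<in>M. (cmod (F (v - w)))\<^sup>2)
      = (\<Sum>w\<in>M'. \<Sum>v\<in>M. \<Sum>p\<in>P. \<Sum>q\<in>P. b p * cnj (b q) * (vec_char v (x p - x q) * cnj (vec_char w (x p - x q))))"
    by (simp only: of_real_sum expand)
  also have "\<dots> = (\<Sum>w\<in>M'. \<Sum>p\<in>P. \<Sum>v\<in>M. \<Sum>q\<in>P. b p * cnj (b q) * (vec_char v (x p - x q) * cnj (vec_char w (x p - x q))))"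
    by (intro sum.cong refl sum.swap)
  also have "\<dots> = (\<Sum>p\<in>P. \<Sum>w\<in>M'. \<Sum>q\<in>P. \<Sum>v\<in>M. b p * cnj (b q) * (vec_char v (x p - x q) * cnj (vec_char w (x p - x q))))"
    by (subst sum.swap) (intro sum.cong refl sum.swap)
  also have "\<dots> = (\<Sum>p\<in>P. \<Sum>q\<in>P. \<Sum>w\<in>M'. \<Sum>v\<in>M. b p * cnj (b q) * (vec_char v (x p - x q) * cnj (vec_char w (x p - x q))))"
    by (intro sum.cong refl sum.swap)
  also have "\<dots> = (\<Sum>p\<in>P. \<Sum>q\<in>P. b p * cnj (b q) * k (x p - x q))"
    by (intro sum.cong refl)
      (simp add: k_def cnj_sum sum_product sum_distrib_left sum_distrib_right mult_ac sum.swap[of _ M M'])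
  finally have "cmod (complex_of_real (\<Sum>w\<in>M'. \<Sum>v\<in>M. (cmod (F (v - w)))\<^sup>2))
      \<le> (\<Sum>p\<in>P. \<Sum>q\<in>P. cmod (b p) * cmod (b q) * W p q)"
    by (auto simp: norm_mult W_def W_sym[unfolded W_def] intro!: sum_norm_le)
  moreover have "0 \<le> (\<Sum>w\<in>M'. \<Sum>v\<in>M. (cmod (F (v - w)))\<^sup>2)" by (intro sum_nonneg) auto
  ultimately have le: "(\<Sum>w\<in>M'. \<Sum>v\<in>M. (cmod (F (v - w)))\<^sup>2)
      \<le> (\<Sum>p\<in>P. \<Sum>q\<in>P. cmod (b p) * cmod (b q) * W p q)"
    by (simp only: norm_of_real abs_of_nonneg)
  \<comment> \<open>In each coordinate both kernels contribute a factor \<open>L * decay\<close>, so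
    the decay appears squared, as in \<open>sum_decay_le\<close>.\<close>
  define H :: "nat ^ 'n \<Rightarrow> real" where "H j = (\<Prod>i\<in>UNIV. (real L)\<^sup>2 * (decay L (j $ i))\<^sup>2)" for j
  define J :: "(nat ^ 'n) set" where "J = {j. \<forall>i. j $ i \<in> {..<L}}"
  have L0: "L > 0" using Z by (simp add: L_def)
  have k_le: "cmod (k \<theta>) \<le> H (\<chi> i. cell L (\<theta> $ i))" for \<theta>
  proof -
    have "cmod (k \<theta>) \<le> (\<Prod>i\<in>UNIV. real L * decay L (cell L (\<theta> $ i))) * (\<Prod>i\<in>UNIV. real L * decay L (cell L (\<theta> $ i)))"
      unfolding k_def norm_mult complex_mod_cnj M_def M'_def
      using L0 by (intro mult_mono norm_vec_char_sum_le prod_nonneg) (auto simp: decay_def L_def)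
    then show ?thesis by (simp add: H_def prod.distrib[symmetric] power2_eq_square mult_ac)
  qed
  have finJ: "finite J" unfolding J_def by (rule finite_vec_componentwise) simp
  have H_nonneg: "H j \<ge> 0" for j by (simp add: H_def prod_nonneg)
  have sumH: "(\<Sum>j\<in>J. H j) \<le> (4 * (real L)\<^sup>2) ^ CARD('n)"
  proof -
    have "(\<Sum>j\<in>J. H j) = (\<Prod>i\<in>(UNIV :: 'n set). \<Sum>a<L. (real L)\<^sup>2 * (decay L a)\<^sup>2)"
      unfolding J_def H_def by (rule sum_prod_vec) simp
    also have "\<dots> \<le> (\<Prod>i\<in>(UNIV :: 'n set). 4 * (real L)\<^sup>2)"
    proof (intro prod_mono conjI)
      show "(\<Sum>a<L. (real L)\<^sup>2 * (decay L a)\<^sup>2) \<le> 4 * (real L)\<^sup>2"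
        using mult_left_mono[OF sum_decay_le[of L], of "(real L)\<^sup>2"]
        by (simp add: sum_distrib_left mult.commute)
    qed (auto intro: sum_nonneg)
    finally show ?thesis by simp
  qed
  have row: "(\<Sum>q\<in>P. W p q) \<le> K * (4 * (real L)\<^sup>2) ^ CARD('n)" if p: "p \<in> P" for p
  proof -
    define c :: "'p \<Rightarrow> nat ^ 'n" where "c q = (\<chi> i. cell L (x q $ i - x p $ i))" for q
    have "(\<Sum>q\<in>P. W p q) \<le> (\<Sum>q\<in>P. H (c q))"
      unfolding W_def c_def by (intro sum_mono order_trans[OF k_le]) simp
    \<comment> \<open>The points are grouped by the cell of their difference from
      \<open>x p\<close>; each group has at most \<open>K\<close> elements and \<open>H\<close> is
      constant on it.\<close>
    also have "\<dots> = (\<Sum>j\<in>J. \<Sum>q\<in>{q\<in>P. c q = j}. H (c q))"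
      by (rule sum.group[symmetric, OF P finJ]) (auto simp: c_def J_def cell_bounds(1)[OF L0])
    also have "\<dots> = (\<Sum>j\<in>J. real (card {q\<in>P. c q = j}) * H j)"
      by (intro sum.cong refl) simp
    also have "\<dots> \<le> (\<Sum>j\<in>J. K * H j)"
    proof (intro sum_mono mult_right_mono H_nonneg)
      fix j
      show "real (card {q\<in>P. c q = j}) \<le> K"
        using cells[OF p, of j] by (simp add: c_def vec_eq_iff L_def)
    qed
    also have "\<dots> \<le> K * (4 * (real L)\<^sup>2) ^ CARD('n)"
      using mult_left_mono[OF sumH K] by (simp add: sum_distrib_left)
    finally show ?thesis .
  qed
  \<comment> \<open>All \<open>Z ^ CARD('n)\<close> translates bound the same sum. Dividing by their
    number removes one power of \<open>Z\<close> per coordinate from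
    \<open>4 * L\<^sup>2 = Z * (36 * Z)\<close>.\<close>
  have "real Z ^ CARD('n) * (\<Sum>\<alpha>\<in>B. (cmod (F \<alpha>))\<^sup>2) = (\<Sum>w\<in>M'. \<Sum>\<alpha>\<in>B. (cmod (F \<alpha>))\<^sup>2)"
    by (simp add: cardM')
  also have "\<dots> \<le> (\<Sum>w\<in>M'. \<Sum>v\<in>M. (cmod (F (v - w)))\<^sup>2)"
    by (rule sum_mono[OF shift])
  also note le
  also have "(\<Sum>p\<in>P. \<Sum>q\<in>P. cmod (b p) * cmod (b q) * W p q)
      \<le> (K * (4 * (real L)\<^sup>2) ^ CARD('n)) * (\<Sum>p\<in>P. (cmod (b p))\<^sup>2)"
    using W_sym row by (intro schur_test) (auto simp: W_def)
  also have "4 * (real L)\<^sup>2 = real Z * (36 * real Z)"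
    by (simp add: L_def power2_eq_square)
  also have "(K * (real Z * (36 * real Z)) ^ CARD('n)) * (\<Sum>p\<in>P. (cmod (b p))\<^sup>2)
      = real Z ^ CARD('n) * (((36 * real Z) ^ CARD('n) * K) * (\<Sum>p\<in>P. (cmod (b p))\<^sup>2))"
    by (simp only: power_mult_distrib mult_ac)
  finally show ?thesis
    using Z by (subst (asm) mult_le_cancel_left_pos) (auto simp: B_def F_def)
qed

section \<open>From the torus to representatives, and the final estimate\<close>

lemma integer_box_eq:
  fixes N :: real
  assumes "N \<ge> 0"
  shows "(integer_box N :: (int ^ 'n) set) = {\<alpha>. \<forall>i. \<alpha> $ i \<in> {- int (nat \<lfloor>N\<rfloor>)..int (nat \<lfloor>N\<rfloor>)}}"
proof -
  have "real_of_int (MAX i\<in>UNIV. \<bar>\<alpha> $ i\<bar>) \<le> N \<longleftrightarrow> (\<forall>i. \<bar>\<alpha> $ i\<bar> \<le> \<lfloor>N\<rfloor>)" for \<alpha> :: "int ^ 'n"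
    by (simp add: le_floor_iff[symmetric])
  then show ?thesis using assms by (auto simp: integer_box_def abs_le_iff minus_le_iff)
qed

lemma torus_points_representative:
  assumes "\<beta> \<in> torus_points X"
  obtains x :: "real ^ 'n" and q :: nat where "\<beta> = integer_lattice #>\<^bsub>euclidean_group\<^esub> x"
    "0 < q" "real q \<le> X" "\<And>i. real q * x $ i \<in> \<int>"
proof -
  obtain x where \<beta>: "\<beta> = integer_lattice #>\<^bsub>euclidean_group\<^esub> x"
    and mem: "\<beta> \<in> carrier torus" and q: "group.ord torus \<beta> \<noteq> 0" "real (group.ord torus \<beta>) \<le> X"
    using assms by (auto simp: torus_points_def carrier_torus)
  have "\<beta> [^]\<^bsub>torus\<^esub> group.ord torus \<beta> = \<one>\<^bsub>torus\<^esub>"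
    by (rule group.pow_ord_eq_1[OF comm_group.axioms(2)[OF comm_group_torus] mem])
  then have "real (group.ord torus \<beta>) *\<^sub>R x \<in> integer_lattice"
    using torus_pow_eq_one_iff[of x "group.ord torus \<beta>"] \<beta> by simp
  then show ?thesis using that[OF \<beta>, of "group.ord torus \<beta>"] q by (auto simp: integer_lattice_def)
qed

lemma torus_char_eq_vec_char:
  "torus_char \<alpha> (integer_lattice #>\<^bsub>euclidean_group\<^esub> x) = vec_char \<alpha> (x :: real ^ 'n)"
  unfolding torus_char_coset e_def vec_char_def cis_conv_exp by (simp add: mult_ac)

lemma coset_eqI:
  fixes x y :: "real ^ 'n"
  assumes "\<And>i. x $ i - y $ i \<in> \<int>"
  shows "integer_lattice #>\<^bsub>euclidean_group\<^esub> x = integer_lattice #>\<^bsub>euclidean_group\<^esub> y"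
  using assms
  by (intro group.repr_independence[OF comm_group.axioms(2)[OF comm_group_euclidean_group] _ _
        subgroup_integer_lattice, symmetric], unfold mem_coset_iff)
    (auto simp: integer_lattice_def)

theorem theorem4:
  fixes \<epsilon> :: real
  assumes "\<epsilon> > 0"
  shows "\<exists>C::real. C > 0 \<and>
    (\<forall>(X::real) (N::real) (c :: int ^ 'n \<Rightarrow> complex). X \<ge> 1 \<longrightarrow> N \<ge> 1 \<longrightarrow>
      (\<Sum>\<beta>\<in>torus_points X. (cmod (\<Sum>\<alpha>\<in>integer_box N. c \<alpha> * torus_char \<alpha> \<beta>))\<^sup>2)
      \<le> C * X powr \<epsilon> * (X ^ (CARD('n) + 1) + N ^ (CARD('n) - 1) * X\<^sup>2 + N ^ CARD('n))
          * (\<Sum>\<alpha>\<in>integer_box N. (cmod (c \<alpha>))\<^sup>2))"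
proof -
  let ?n = "CARD('n)"
  obtain C where C: "C > 0" and count: "\<And>X l (\<gamma> :: real ^ 'n). X \<ge> 1 \<Longrightarrow> l > 0 \<Longrightarrow>
    finite (torsion_box X l \<gamma>) \<and> real (card (torsion_box X l \<gamma>))
      \<le> C * X powr \<epsilon> * (X ^ (?n + 1) * l ^ ?n + X\<^sup>2 * l + 1)"
    using card_torsion_box_le[OF assms] by blast
  have "(\<Sum>\<beta>\<in>torus_points X. (cmod (\<Sum>\<alpha>\<in>integer_box N. c \<alpha> * torus_char \<alpha> \<beta>))\<^sup>2)
      \<le> 36 ^ ?n * C * X powr \<epsilon> * (X ^ (?n + 1) + N ^ (?n - 1) * X\<^sup>2 + N ^ ?n)
          * (\<Sum>\<alpha>\<in>integer_box N. (cmod (c \<alpha>))\<^sup>2)"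
    if X: "X \<ge> 1" and N: "N \<ge> 1" for X N and c :: "int ^ 'n \<Rightarrow> complex"
  proof -
    define P :: "(real ^ 'n) set set" where "P = torus_points X"
    define Z where "Z = nat \<lfloor>N\<rfloor>"
    define L where "L = 3 * Z"
    \<comment> \<open>The side of a cell in \<open>large_sieve_dual\<close>, so that
      \<open>count\<close> bounds the number of points in a cell.\<close>
    define l where "l = 1 / real L"
    have Z: "Z > 0" "real Z \<le> N" using N by (auto simp: Z_def)
    then have L: "L > 0" by (simp add: L_def)
    then have l: "l > 0" by (simp add: l_def)
    have "\<forall>\<beta>\<in>P. \<exists>x. \<beta> = integer_lattice #>\<^bsub>euclidean_group\<^esub> x \<and>
        (\<exists>q::nat. 0 < q \<and> real q \<le> X \<and> (\<forall>i. real q * x $ i \<in> \<int>))"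
      unfolding P_def by (meson torus_points_representative)
    then obtain x where x: "\<And>\<beta>. \<beta> \<in> P \<Longrightarrow> \<beta> = integer_lattice #>\<^bsub>euclidean_group\<^esub> x \<beta>"
      and xq: "\<And>\<beta>. \<beta> \<in> P \<Longrightarrow> \<exists>q::nat. 0 < q \<and> real q \<le> X \<and> (\<forall>i. real q * x \<beta> $ i \<in> \<int>)"
      by metis
    define K where "K = C * X powr \<epsilon> * (X ^ (?n + 1) * l ^ ?n + X\<^sup>2 * l + 1)"
    have K0: "K \<ge> 0" using C X l by (simp add: K_def)
    have cells: "real (card {q \<in> P. \<forall>i. cell (3 * Z) (x q $ i - x p $ i) = j $ i}) \<le> K"
      for p and j :: "nat ^ 'n"
    proof -
      \<comment> \<open>The corner of the \<open>j\<close>-th cell as seen from \<open>x p\<close>.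
        Below, \<open>y q\<close> is the representative of \<open>q\<close> with coordinates in the
        unit intervals starting at those of \<open>x p\<close>, which turns the cell condition into
        membership in a box.\<close>
      define \<gamma> :: "real ^ 'n" where "\<gamma> = (\<chi> i. x p $ i + real (j $ i) / real L)"
      define Q where "Q = {q \<in> P. \<forall>i. cell (3 * Z) (x q $ i - x p $ i) = j $ i}"
      define y :: "(real ^ 'n) set \<Rightarrow> real ^ 'n" where "y q = (\<chi> i. x p $ i + frac (x q $ i - x p $ i))" for q
      have yx: "y q $ i = x q $ i - of_int \<lfloor>x q $ i - x p $ i\<rfloor>" for q i
        by (simp add: y_def frac_def)
      \<comment> \<open>Equal values of \<open>y\<close> force the original representatives to
        differ by a lattice vector, so their cosets coincide.\<close>
      have "inj_on y Q"
      proof (rule inj_onI)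
        fix q r assume qr: "q \<in> Q" "r \<in> Q" "y q = y r"
        have "x q $ i - x r $ i \<in> \<int>" for i
        proof -
          have "y q $ i = y r $ i" using qr(3) by simp
          then have "x q $ i - x r $ i = of_int (\<lfloor>x q $ i - x p $ i\<rfloor> - \<lfloor>x r $ i - x p $ i\<rfloor>)"
            by (simp add: yx)
          then show ?thesis by (metis Ints_of_int)
        qed
        then have "integer_lattice #>\<^bsub>euclidean_group\<^esub> x q = integer_lattice #>\<^bsub>euclidean_group\<^esub> x r"
          by (rule coset_eqI)
        then show "q = r" using x qr by (simp add: Q_def)
      qed
      moreover have "y ` Q \<subseteq> torsion_box X l \<gamma>"
      proof clarify
        fix q assume q: "q \<in> Q"
        have "\<gamma> $ i \<le> y q $ i \<and> y q $ i < \<gamma> $ i + l" for i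
        proof -
          have "cell L (x q $ i - x p $ i) = j $ i" using q by (simp add: Q_def L_def)
          then show ?thesis
            using cell_bounds(2,3)[OF L, of "x q $ i - x p $ i"] L
            by (simp add: \<gamma>_def y_def l_def field_simps)
        qed
        moreover obtain r :: nat where r: "0 < r" "real r \<le> X" "\<And>i. real r * x q $ i \<in> \<int>"
          using xq[of q] q by (auto simp: Q_def)
        moreover have "real r * y q $ i \<in> \<int>" for i
          unfolding yx right_diff_distrib by (intro Ints_diff r(3) Ints_mult Ints_of_nat Ints_of_int)
        ultimately show "y q \<in> torsion_box X l \<gamma>" by (auto simp: torsion_box_def)
      qed
      ultimately have "card Q \<le> card (torsion_box X l \<gamma>)"
        using count[OF X l, of \<gamma>] by (intro card_inj_on_le) auto
      also have "real (card (torsion_box X l \<gamma>)) \<le> K"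
        using count[OF X l, of \<gamma>] by (simp add: K_def)
      finally show ?thesis by (simp add: Q_def)
    qed
    have box: "(integer_box N :: (int ^ 'n) set) = {\<alpha>. \<forall>i. \<alpha> $ i \<in> {- int Z..int Z}}"
      unfolding Z_def by (rule integer_box_eq) (use N in simp)
    have "(\<Sum>\<beta>\<in>P. (cmod (\<Sum>\<alpha>\<in>integer_box N. c \<alpha> * torus_char \<alpha> \<beta>))\<^sup>2)
        = (\<Sum>\<beta>\<in>P. (cmod (\<Sum>\<alpha>\<in>integer_box N. c \<alpha> * vec_char \<alpha> (x \<beta>)))\<^sup>2)"
    proof (rule sum.cong[OF refl])
      fix \<beta> assume "\<beta> \<in> P"
      then have "torus_char \<alpha> \<beta> = vec_char \<alpha> (x \<beta>)" for \<alpha> using x torus_char_eq_vec_char by metis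
      then show "(cmod (\<Sum>\<alpha>\<in>integer_box N. c \<alpha> * torus_char \<alpha> \<beta>))\<^sup>2
          = (cmod (\<Sum>\<alpha>\<in>integer_box N. c \<alpha> * vec_char \<alpha> (x \<beta>)))\<^sup>2" by simp
    qed
    also have "\<dots> \<le> ((36 * real Z) ^ ?n * K) * (\<Sum>\<alpha>\<in>integer_box N. (cmod (c \<alpha>))\<^sup>2)"
      unfolding box
    proof (rule duality_principle)
      show "0 \<le> (36 * real Z) ^ ?n * K" using K0 by simp
      show "(\<Sum>\<alpha>\<in>{\<alpha>. \<forall>i. \<alpha> $ i \<in> {- int Z..int Z}}. (cmod (\<Sum>p\<in>P. b p * vec_char \<alpha> (x p)))\<^sup>2)
          \<le> ((36 * real Z) ^ ?n * K) * (\<Sum>p\<in>P. (cmod (b p))\<^sup>2)" for b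
        unfolding P_def
        by (rule large_sieve_dual[OF finite_torus_points Z(1) K0 cells[unfolded P_def]])
    qed
    also have "\<dots> \<le> (36 ^ ?n * C * X powr \<epsilon> * (X ^ (?n + 1) + N ^ (?n - 1) * X\<^sup>2 + N ^ ?n))
        * (\<Sum>\<alpha>\<in>integer_box N. (cmod (c \<alpha>))\<^sup>2)"
    proof (rule mult_right_mono)
      \<comment> \<open>Each factor \<open>l\<close> in \<open>K\<close> absorbs one factor of
        \<open>Z ^ ?n\<close>, which turns the three summands of \<open>K\<close> into the three
        terms of the bound.\<close>
      have Zl: "real Z * l = 1 / 3" using Z by (simp add: l_def L_def)
      have "real Z ^ ?n * (X ^ (?n + 1) * l ^ ?n) = X ^ (?n + 1) * (1 / 3) ^ ?n"
        by (simp flip: Zl add: power_mult_distrib mult_ac)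
      also have "\<dots> \<le> X ^ (?n + 1)"
        using X by (intro mult_left_le power_le_one) auto
      finally have 1: "real Z ^ ?n * (X ^ (?n + 1) * l ^ ?n) \<le> X ^ (?n + 1)" .
      have "real Z ^ ?n = real Z ^ (?n - 1) * real Z"
        by (metis power_minus_mult zero_less_card_finite)
      then have "real Z ^ ?n * (X\<^sup>2 * l) = real Z ^ (?n - 1) * X\<^sup>2 * (real Z * l)" by simp
      also have "\<dots> \<le> real Z ^ (?n - 1) * X\<^sup>2" by (rule mult_left_le) (auto simp: Zl)
      also have "\<dots> \<le> N ^ (?n - 1) * X\<^sup>2" using Z by (intro mult_right_mono power_mono) auto
      finally have 2: "real Z ^ ?n * (X\<^sup>2 * l) \<le> N ^ (?n - 1) * X\<^sup>2" .
      have 3: "real Z ^ ?n \<le> N ^ ?n" using Z by (intro power_mono) auto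
      have "(36 * real Z) ^ ?n * K = (36 ^ ?n * C * X powr \<epsilon>)
          * (real Z ^ ?n * (X ^ (?n + 1) * l ^ ?n) + real Z ^ ?n * (X\<^sup>2 * l) + real Z ^ ?n)"
        unfolding K_def power_mult_distrib by (simp only: distrib_left mult_1_right mult_ac)
      also have "\<dots> \<le> (36 ^ ?n * C * X powr \<epsilon>) * (X ^ (?n + 1) + N ^ (?n - 1) * X\<^sup>2 + N ^ ?n)"
        using C by (intro mult_left_mono add_mono 1 2 3) auto
      finally show "(36 * real Z) ^ ?n * K
          \<le> 36 ^ ?n * C * X powr \<epsilon> * (X ^ (?n + 1) + N ^ (?n - 1) * X\<^sup>2 + N ^ ?n)" .
    qed (auto intro: sum_nonneg)
    finally show ?thesis by (simp add: P_def)
  qed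
  then show ?thesis using C by (intro exI[of _ "36 ^ ?n * C"]) auto
qed

end
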